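(* Let $G$ be a $\{3K_1,\text{paraglider}\}$-free graph. Then $oh(G)\ge\chi(G)$.
   Context: $3K_1$ is the edgeless graph on 3 vertices. A paraglider is the graph obtained from a 4-cycle by adding a vertex adjacent to exactly three vertices of the 4-cycle. $G$ is $\mathcal F$-free if it has no induced subgraph isomorphic to a member of $\mathcal F$. $\chi(G)$ is the chromatic number. A graph $G$ has an odd $K_t$ minor if there are $t$ pairwise vertex-disjoint trees in $G$, every two joined by an edge, and the vertices of the trees can be 2-colored so that edges within each tree are bichromatic and the edges joining different trees are monochromatic. $oh(G)$ is the largest $\ell$ such that $G$ has an odd $K_\ell$ minor. *)

theory Defs
  imports "Graph_Theory.Graph_Theory"
begin

text \<open>
  A finite simple undirected graph is a \<^locale>\<open>pair_graph\<close>: a finite digraph without loops and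
  parallel arcs whose arc set is symmetric. An undirected edge is the pair of arcs
  \<open>(u,v)\<close>, \<open>(v,u)\<close>.
\<close>

definition edgeless_graph_3 :: "nat pair_pre_digraph" where
  "edgeless_graph_3 = \<lparr> pverts = {0, 1, 2}, parcs = {} \<rparr>"

text \<open>The 4-cycle is \<open>0, 1, 2, 3\<close>; the added vertex is \<open>4\<close>.\<close>

definition paraglider :: "nat pair_pre_digraph" where
  "paraglider = \<lparr> pverts = {0, 1, 2, 3, 4},
     parcs = (let E = {(0, 1), (1, 2), (2, 3), (3, 0), (4, 0), (4, 1), (4, 2)} in E \<union> E\<inverse>) \<rparr>"

lemma pair_graph_edgeless_graph_3: "pair_graph edgeless_graph_3"
  by unfold_locales (auto simp: edgeless_graph_3_def symmetric_def sym_def)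

lemma pair_graph_paraglider: "pair_graph paraglider"
  by unfold_locales (auto simp: paraglider_def symmetric_def sym_def Let_def)

definition free_of :: "nat pair_pre_digraph set \<Rightarrow> 'a pair_pre_digraph \<Rightarrow> bool" where
  "free_of \<F> G \<longleftrightarrow>
     (\<forall>F\<in>\<F>. \<not> (\<exists>H. induced_subgraph H (with_proj G) \<and> digraph_iso H (with_proj F)))"

definition proper_coloring :: "'a pair_pre_digraph \<Rightarrow> nat \<Rightarrow> ('a \<Rightarrow> nat) \<Rightarrow> bool" where
  "proper_coloring G k c \<longleftrightarrow>
     (\<forall>v\<in>pverts G. c v < k) \<and> (\<forall>(u, v)\<in>parcs G. c u \<noteq> c v)"

definition chromatic_number :: "'a pair_pre_digraph \<Rightarrow> nat" where
  "chromatic_number G = (LEAST k. \<exists>c. proper_coloring G k c)"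

text \<open>
  The library's \<^const>\<open>tree\<close> is not usable here: it forbids directed cycles, and every undirected
  edge gives a directed cycle \<open>u, v, u\<close> of length 2. Directed cycles of length at least 3 in a
  \<^locale>\<open>pair_graph\<close> are exactly the traversals of undirected cycles.
  Note that \<^const>\<open>connected\<close> includes having at least one vertex.
\<close>

definition undirected_tree :: "'a pair_pre_digraph \<Rightarrow> bool" where
  "undirected_tree T \<longleftrightarrow> pair_graph T \<and> connected (with_proj T) \<and>
     \<not> (\<exists>p. pre_digraph.cycle (with_proj T) p \<and> length p \<ge> 3)"

text \<open>
  The trees are arbitrary, not necessarily induced, subgraphs of \<open>G\<close>. As usual for odd minors, the
  colour condition concerns the edges of the trees and, for every two trees, one edge
  joining them; the remaining edges of \<open>G\<close> are unconstrained.
\<close>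

definition has_odd_clique_minor :: "'a pair_pre_digraph \<Rightarrow> nat \<Rightarrow> bool" where
  "has_odd_clique_minor G t \<longleftrightarrow>
     (\<exists>(T :: nat \<Rightarrow> 'a pair_pre_digraph) (c :: 'a \<Rightarrow> bool).
        (\<forall>i<t. undirected_tree (T i) \<and> subgraph (with_proj (T i)) (with_proj G)) \<and>
        (\<forall>i<t. \<forall>j<t. i \<noteq> j \<longrightarrow> pverts (T i) \<inter> pverts (T j) = {}) \<and>
        (\<forall>i<t. \<forall>(u, v)\<in>parcs (T i). c u \<noteq> c v) \<and>
        (\<forall>i<t. \<forall>j<t. i \<noteq> j \<longrightarrow>
           (\<exists>u\<in>pverts (T i). \<exists>v\<in>pverts (T j). (u, v) \<in> parcs G \<and> c u = c v)))"

definition oh :: "'a pair_pre_digraph \<Rightarrow> nat" where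
  "oh G = (GREATEST l. has_odd_clique_minor G l)"

text \<open>The minimum and the maximum above are attained for every finite graph.\<close>

lemma ex_proper_coloring:
  assumes "pair_graph G"
  shows "\<exists>k c. proper_coloring G k c"
proof -
  interpret pair_graph G by fact
  obtain c :: "'a \<Rightarrow> nat" and n where c: "c ` pverts G = {i. i < n}" "inj_on c (pverts G)"
    using finite_imp_inj_to_nat_seg[OF pair_finite_verts] by blast
  have "c u \<noteq> c v" if "(u, v) \<in> parcs G" for u v
    using that c(2) pair_no_loops[OF that] in_arcsD1[OF that] in_arcsD2[OF that]
    by (auto dest: inj_onD)
  then have "proper_coloring G n c"
    using c(1) by (auto simp: proper_coloring_def)
  then show ?thesis by blast
qed

lemma has_odd_clique_minor_0: "has_odd_clique_minor G 0"
  by (simp add: has_odd_clique_minor_def)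

lemma has_odd_clique_minor_le_card:
  assumes "pair_graph G" and "has_odd_clique_minor G t"
  shows "t \<le> card (pverts G)"
proof -
  interpret pair_graph G by fact
  obtain T :: "nat \<Rightarrow> 'a pair_pre_digraph" where
    T: "\<forall>i<t. undirected_tree (T i) \<and> subgraph (with_proj (T i)) (with_proj G)"
    and disj: "\<forall>i<t. \<forall>j<t. i \<noteq> j \<longrightarrow> pverts (T i) \<inter> pverts (T j) = {}"
    using assms(2) unfolding has_odd_clique_minor_def by blast
  have ne: "\<forall>i<t. \<exists>v. v \<in> pverts (T i)"
    using T by (auto simp: undirected_tree_def connected_def strongly_connected_def
        mk_symmetric_def)
  then obtain f where f: "\<forall>i<t. f i \<in> pverts (T i)" by metis
  have "inj_on f {..<t}"
    using f disj by (auto simp: inj_on_def) (metis disjoint_iff)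
  moreover have "f ` {..<t} \<subseteq> pverts G"
    using f T by (auto simp: subgraph_def)
  ultimately show ?thesis
    using card_inj_on_le[of f "{..<t}" "pverts G"] pair_finite_verts by simp
qed

end

theory Submission
  imports Defs
begin

text \<open>
  Let \<open>H\<close> be the complement of \<open>G\<close>. It has no triangle and no induced \<open>P\<^sub>3 + K\<^sub>2\<close>. An edge \<open>ab\<close>
  of \<open>H\<close> and a vertex \<open>c\<close> adjacent to neither end form an induced path \<open>a - c - b\<close> (a seagull)
  of \<open>G\<close>. If its ends get the colour \<open>True\<close> and \<open>c\<close> gets \<open>False\<close>, then every other vertex of
  colour \<open>True\<close> has a neighbour of the same colour on it. Hence an independent set \<open>S\<close> of \<open>H\<close>
  and \<open>p\<close> disjoint seagulls outside of \<open>S\<close> give an odd clique minor of order \<open>|S| + p\<close>. A matching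
  of \<open>H\<close> is a colouring of \<open>G\<close>, so it suffices to find \<open>S\<close> and \<open>p\<close> with \<open>|S| + p \<ge> n - \<nu>(H)\<close>.

  By induction and Gallai's lemma one may assume that \<open>H\<close> is factor-critical with \<open>n = 2k + 1\<close>.
  Let \<open>A\<close> be the neighbourhood of a vertex of maximum degree. If two vertices of \<open>A\<close> missed an edge
  outside of \<open>A\<close>, there would be an induced \<open>P\<^sub>3 + K\<^sub>2\<close>. So the ends of such an edge have at
  least \<open>|A| - 1\<close> neighbours in \<open>A\<close>, and few outside of it. A matching missing only
  a vertex of \<open>A\<close> has \<open>s = k + 1 - |A|\<close> edges outside of \<open>A\<close>, and the degree bound lets one
  complete them to \<open>s\<close> disjoint seagulls, apart from one configuration on nine vertices.
\<close>

section \<open>Matchings and Gallai's lemma\<close>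

locale simple_graph =
  fixes adj :: "'a \<Rightarrow> 'a \<Rightarrow> bool"
  assumes adj_sym: "adj x y \<Longrightarrow> adj y x"
    and adj_irrefl: "\<not> adj x x"
begin

lemma adj_commute: "adj x y \<longleftrightarrow> adj y x"
  using adj_sym by blast

definition indep :: "'a set \<Rightarrow> bool" where
  "indep S \<longleftrightarrow> (\<forall>x\<in>S. \<forall>y\<in>S. \<not> adj x y)"

text \<open>A matching is the involution that swaps matched vertices and fixes all others.\<close>

definition matching :: "'a set \<Rightarrow> ('a \<Rightarrow> 'a) \<Rightarrow> bool" where
  "matching V f \<longleftrightarrow> (\<forall>x. f (f x) = x) \<and> (\<forall>x. f x \<noteq> x \<longrightarrow> x \<in> V \<and> adj x (f x))"

definition unmatched :: "'a set \<Rightarrow> ('a \<Rightarrow> 'a) \<Rightarrow> 'a set" where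
  "unmatched V f = {x \<in> V. f x = x}"

definition max_matching :: "'a set \<Rightarrow> ('a \<Rightarrow> 'a) \<Rightarrow> bool" where
  "max_matching V f \<longleftrightarrow> matching V f \<and>
     (\<forall>g. matching V g \<longrightarrow> card (unmatched V f) \<le> card (unmatched V g))"

lemma matching_invol [simp]: "matching V f \<Longrightarrow> f (f x) = x"
  by (simp add: matching_def)

lemma matching_eq_iff: "matching V f \<Longrightarrow> f x = f y \<longleftrightarrow> x = y"
  by (metis matching_invol)

lemma matching_adj: "matching V f \<Longrightarrow> f x \<noteq> x \<Longrightarrow> adj x (f x)"
  by (simp add: matching_def)

lemma matching_inV: "matching V f \<Longrightarrow> f x \<noteq> x \<Longrightarrow> x \<in> V"
  by (simp add: matching_def)

lemma matching_in: "matching V f \<Longrightarrow> x \<in> V \<Longrightarrow> f x \<in> V"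
  by (metis matching_def)

lemma matching_id: "matching V (\<lambda>x. x)"
  by (simp add: matching_def)

lemma matching_mono: "matching V f \<Longrightarrow> V \<subseteq> V' \<Longrightarrow> matching V' f"
  by (auto simp: matching_def)

lemma unmatched_subset: "unmatched V f \<subseteq> V"
  by (auto simp: unmatched_def)

lemma ex_max_matching: "\<exists>f. max_matching V f"
proof -
  obtain f where "matching V f" "\<forall>g. matching V g \<longrightarrow> card (unmatched V f) \<le> card (unmatched V g)"
    using ex_has_least_nat[of "matching V" "\<lambda>x. x" "\<lambda>f. card (unmatched V f)"] matching_id by blast
  then show ?thesis by (auto simp: max_matching_def)
qed

lemma card_involution_classes:
  assumes "finite V" and ff: "\<And>x. f (f x) = x" and fV: "\<And>x. x \<in> V \<Longrightarrow> f x \<in> V"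
  shows "2 * card ((\<lambda>x. {x, f x}) ` V) = card V + card {x \<in> V. f x = x}"
proof -
  let ?c = "\<lambda>x. {x, f x}"
  let ?U = "{x \<in> V. f x = x}"
  have eq: "f x = f y \<longleftrightarrow> x = y" for x y
    by (metis ff)
  have split: "?c ` V = ?c ` ?U \<union> ?c ` (V - ?U)"
    by blast
  have disj: "?c ` ?U \<inter> ?c ` (V - ?U) = {}"
    by (auto simp: doubleton_eq_iff)
  have inj: "inj_on ?c ?U"
    by (auto simp: inj_on_def)
  have two: "card {x, f x} = 2" if "f x \<noteq> x" for x
    using that by (metis card_2_iff)
  have "card (V - ?U) = card (\<Union> (?c ` (V - ?U)))"
    using fV ff by (intro arg_cong[of _ _ card]) auto
  also have "\<dots> = (\<Sum>A\<in>?c ` (V - ?U). card A)"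
    using ff eq by (intro card_Union_disjoint) (auto simp: pairwise_def disjnt_def)
  also have "\<dots> = (\<Sum>A\<in>?c ` (V - ?U). 2)"
    by (intro sum.cong refl) (use two fV in \<open>blast+\<close>)
  finally have "card (V - ?U) = 2 * card (?c ` (V - ?U))"
    by simp
  moreover have "card (?c ` V) = card (?c ` ?U) + card (?c ` (V - ?U))"
    unfolding split using assms(1) disj by (intro card_Un_disjoint) auto
  moreover have "card (?c ` ?U) = card ?U"
    by (rule card_image[OF inj])
  moreover have "card V = card ?U + card (V - ?U)"
    using assms(1) by (subst card_Un_disjoint[symmetric]) (auto intro: arg_cong[of _ _ card])
  ultimately show ?thesis by simp
qed

text \<open>A matching of the complement is a colouring whose colour classes are the sets
  \<open>{x, f x}\<close>. Comparing numbers of unmatched vertices is thus the same as comparing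
  numbers of colours.\<close>

lemma card_matching_classes:
  assumes "finite V" and f: "matching V f"
  shows "2 * card ((\<lambda>x. {x, f x}) ` V) = card V + card (unmatched V f)"
  using card_involution_classes[OF assms(1), of f] f matching_in[OF f]
  by (simp add: unmatched_def)

lemma unmatched_Diff:
  assumes "matching (V - {v}) f" "v \<in> V"
  shows "unmatched V f = insert v (unmatched (V - {v}) f)"
  using assms by (auto simp: unmatched_def matching_def)

lemma matching_glue:
  assumes f: "matching V f" and g: "matching V g"
    and "\<And>x. x \<in> B \<Longrightarrow> f x \<in> B" "\<And>x. x \<in> B \<Longrightarrow> g x \<in> B"
  shows "matching V (\<lambda>x. if x \<in> B then g x else f x)"
  using assms unfolding matching_def by (smt (verit))

text \<open>
  Exchange \<open>f\<close> and \<open>g\<close> on the orbit of \<open>v\<close> under \<open>h = g \<circ> f\<close>. If \<open>f\<close> fixes the points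
  \<open>h\<^sup>i v\<close> and \<open>h\<^sup>j v\<close>, then \<open>h\<close> to the odd powers \<open>2i+1\<close> and \<open>2j+1\<close> fixes \<open>v\<close>, so \<open>h\<^sup>i v = h\<^sup>j v\<close>.
  Hence one of \<open>u\<close>, \<open>w\<close> is outside of the orbit.
\<close>

lemma max_matching_exchange:
  assumes fin: "finite V" and f: "max_matching V f" and g: "max_matching V g"
    and u: "u \<in> unmatched V f" and w: "w \<in> unmatched V f" and "u \<noteq> w"
    and v: "v \<in> unmatched V g"
  shows "\<exists>h. max_matching V h \<and> v \<in> unmatched V h \<and> (u \<in> unmatched V h \<or> w \<in> unmatched V h)"
proof -
  have fm: "matching V f" and gm: "matching V g"
    using f g by (auto simp: max_matching_def)
  have ff [simp]: "f (f x) = x" and gg [simp]: "g (g x) = x" for x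
    using fm gm by auto
  have gv: "g v = v" and vV: "v \<in> V" using v by (auto simp: unmatched_def)
  define h where "h x = g (f x)" for x
  define B where "B = {(h ^^ i) v | i. True}"
  have injh: "inj h"
    unfolding h_def by (metis ff gg injI)
  have hV: "(h ^^ i) v \<in> V" for i
    by (induction i) (auto simp: vV h_def intro: matching_in[OF fm] matching_in[OF gm])
  have BV: "B \<subseteq> V" using hV by (auto simp: B_def)
  have finj: "inj (h ^^ i)" for i
    using injh by (rule inj_fn)
  \<comment> \<open>The orbit of \<open>v\<close> stays in the finite set \<open>V\<close>. As
    \<open>h\<close> is injective, it returns to \<open>v\<close> itself after some
    \<open>N > 0\<close> steps, so forward powers suffice for \<open>B\<close>.\<close>
  have "\<not> inj_on (\<lambda>i. (h ^^ i) v) UNIV"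
  proof
    assume "inj_on (\<lambda>i. (h ^^ i) v) (UNIV :: nat set)"
    then have "infinite (range (\<lambda>i. (h ^^ i) v))"
      using finite_imageD by blast
    moreover have "range (\<lambda>i. (h ^^ i) v) \<subseteq> V" using hV by auto
    ultimately show False using fin finite_subset by blast
  qed
  then obtain i j where ij: "i < j" "(h ^^ i) v = (h ^^ j) v"
    unfolding inj_on_def by (metis nat_neq_iff)
  define N where "N = j - i"
  have "(h ^^ i) v = (h ^^ i) ((h ^^ N) v)"
    using ij by (simp add: N_def flip: funpow_add[unfolded o_def, THEN fun_cong])
  then have hN: "(h ^^ N) v = v"
    using injD[OF finj, of i v "(h ^^ N) v"] by simp
  have N: "N > 0"
    using ij(1) by (simp add: N_def)
  have mult: "(h ^^ (n * m)) v = v" if "(h ^^ n) v = v" for n m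
    using that by (induction m) (auto simp: funpow_add)
  \<comment> \<open>\<open>f\<close> conjugates \<open>h\<close> to its inverse. Iterated at
    \<open>v\<close> and combined with \<open>g v = v\<close>, this gives \<open>key\<close>, which
    places \<open>f\<close> of an orbit point on the orbit.\<close>
  have hfh: "h (f (h x)) = f x" for x
    by (simp add: h_def)
  have hif: "(h ^^ i) (f ((h ^^ i) v)) = f v" for i
  proof (induction i)
    case (Suc i)
    have "(h ^^ Suc i) (f ((h ^^ Suc i) v)) = (h ^^ i) (h (f (h ((h ^^ i) v))))"
      by (simp add: funpow_swap1)
    then show ?case using Suc hfh by simp
  qed simp
  have key: "(h ^^ Suc i) (f ((h ^^ i) v)) = v" for i
    using hif[of i] by (simp add: h_def gv)
  have fB: "f x \<in> B" if x: "x \<in> B" for x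
  proof -
    obtain i where i: "x = (h ^^ i) v" using x by (auto simp: B_def)
    obtain n where n: "N * Suc i = Suc i + n"
      using N by (metis le_add1 le_Suc_ex mult.commute mult_le_mono2 nat_mult_1_right Suc_leI One_nat_def)
    have "(h ^^ Suc i) ((h ^^ n) v) = v"
      using mult[OF hN, of "Suc i"] unfolding n by (simp only: funpow_add o_apply)
    then have "f x = (h ^^ n) v"
      using key[of i] injD[OF finj[of "Suc i"]] i by metis
    then show ?thesis by (auto simp: B_def)
  qed
  have gB: "g x \<in> B" if x: "x \<in> B" for x
  proof -
    obtain i where "f x = (h ^^ i) v" using fB[OF x] by (auto simp: B_def)
    then have "g x = (h ^^ Suc i) v" by (metis ff funpow.simps(2) h_def comp_apply)
    then show ?thesis by (auto simp: B_def simp del: funpow.simps)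
  qed
  have fixed: "(h ^^ (2 * i + 1)) v = v" if "f ((h ^^ i) v) = (h ^^ i) v" for i
    using key[of i] that by (simp add: mult_2 funpow_add)
  have le: "(h ^^ i) v = (h ^^ j) v"
    if i: "f ((h ^^ i) v) = (h ^^ i) v" and j: "f ((h ^^ j) v) = (h ^^ j) v" and "i \<le> j" for i j
  proof -
    \<comment> \<open>Both \<open>2 * d\<close> and \<open>2 * i + 1\<close> are periods at
      \<open>v\<close>. Since \<open>(2 * i + 1) * d = d + 2 * d * i\<close>, so is
      \<open>d\<close>.\<close>
    define d where "d = j - i"
    have "(h ^^ (2 * i + 1)) ((h ^^ (2 * d)) v) = (h ^^ (2 * j + 1)) v"
      using that(3) by (simp add: d_def algebra_simps flip: funpow_add[unfolded o_def, THEN fun_cong])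
    then have "(h ^^ (2 * i + 1)) ((h ^^ (2 * d)) v) = (h ^^ (2 * i + 1)) v"
      using fixed[OF i] fixed[OF j] by simp
    then have d2: "(h ^^ (2 * d)) v = v" using injD[OF finj] by blast
    have "(h ^^ d) v = (h ^^ d) ((h ^^ (2 * d * i)) v)" using mult[OF d2] by simp
    also have "\<dots> = (h ^^ ((2 * i + 1) * d)) v"
      by (simp add: algebra_simps flip: funpow_add[unfolded o_def, THEN fun_cong])
    also have "\<dots> = v" using mult[OF fixed[OF i]] .
    finally have "(h ^^ d) v = v" .
    then have "(h ^^ i) v = (h ^^ (i + d)) v" by (simp add: funpow_add)
    then show ?thesis using that(3) by (simp add: d_def)
  qed
  have one: "\<not> (u \<in> B \<and> w \<in> B)"
  proof
    assume "u \<in> B \<and> w \<in> B"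
    then obtain i j where "u = (h ^^ i) v" "w = (h ^^ j) v" by (auto simp: B_def)
    moreover have "f u = u" "f w = w" using u w by (auto simp: unmatched_def)
    ultimately show False using \<open>u \<noteq> w\<close> le[of i j] le[of j i] by (metis nat_le_linear)
  qed
  define f' where "f' = (\<lambda>x. if x \<in> B then g x else f x)"
  define g' where "g' = (\<lambda>x. if x \<in> B then f x else g x)"
  have f'm: "matching V f'" unfolding f'_def by (rule matching_glue[OF fm gm fB gB])
  have g'm: "matching V g'" unfolding g'_def by (rule matching_glue[OF gm fm gB fB])
  \<comment> \<open>Inside \<open>B\<close> the fixed points of \<open>f\<close> and
    \<open>g\<close> change places, so the two numbers of unmatched vertices keep their sum. As
    \<open>g'\<close> leaves at least as many as \<open>g\<close>, \<open>f'\<close> leaves at most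
    as many as \<open>f\<close>.\<close>
  have cnt: "card (unmatched V k) = card {x \<in> V \<inter> B. k x = x} + card {x \<in> V - B. k x = x}" for k
    using fin by (subst card_Un_disjoint[symmetric]) (auto simp: unmatched_def intro: arg_cong[of _ _ card])
  have "card (unmatched V f') = card {x \<in> V \<inter> B. g x = x} + card {x \<in> V - B. f x = x}"
    unfolding cnt[of f'] by (intro arg_cong2[of _ _ _ _ "(+)"] arg_cong[of _ _ card]) (auto simp: f'_def)
  moreover have "card (unmatched V g') = card {x \<in> V \<inter> B. f x = x} + card {x \<in> V - B. g x = x}"
    unfolding cnt[of g'] by (intro arg_cong2[of _ _ _ _ "(+)"] arg_cong[of _ _ card]) (auto simp: g'_def)
  moreover have "card (unmatched V f) = card (unmatched V g)"
    using f g by (meson max_matching_def order_antisym)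
  moreover have "card (unmatched V g) \<le> card (unmatched V g')"
    using g g'm by (auto simp: max_matching_def)
  ultimately have "card (unmatched V f') \<le> card (unmatched V f)"
    using cnt[of f] cnt[of g] by simp
  then have "max_matching V f'"
    using f f'm by (meson max_matching_def order_trans)
  moreover have "v \<in> B" unfolding B_def by (metis (mono_tags, lifting) mem_Collect_eq funpow_0)
  then have "v \<in> unmatched V f'" using v by (simp add: f'_def unmatched_def)
  moreover have "u \<in> unmatched V f' \<or> w \<in> unmatched V f'"
    using one u w by (auto simp: f'_def unmatched_def)
  ultimately show ?thesis by blast
qed

text \<open>Gallai: this is an equivalence relation if every vertex is missed by some maximum matching.\<close>

definition linked :: "'a set \<Rightarrow> 'a \<Rightarrow> 'a \<Rightarrow> bool" where
  "linked V x y \<longleftrightarrow> x = y \<or> \<not> (\<exists>f. max_matching V f \<and> x \<in> unmatched V f \<and> y \<in> unmatched V f)"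

text \<open>A maximum matching missing \<open>x\<close> and \<open>z\<close> could be exchanged for
  one missing \<open>y\<close> and one of \<open>x\<close>, \<open>z\<close>, against one of the two
  hypotheses.\<close>

lemma linked_trans:
  assumes "finite V" and crit: "\<exists>g. max_matching V g \<and> y \<in> unmatched V g"
    and "linked V x y" "linked V y z"
  shows "linked V x z"
proof (rule ccontr)
  assume "\<not> linked V x z"
  then obtain f where f: "max_matching V f" "x \<in> unmatched V f" "z \<in> unmatched V f" "x \<noteq> z"
    by (auto simp: linked_def)
  obtain g where g: "max_matching V g" "y \<in> unmatched V g" using crit by blast
  obtain h where h: "max_matching V h" "y \<in> unmatched V h" "x \<in> unmatched V h \<or> z \<in> unmatched V h"
    using max_matching_exchange[OF assms(1) f(1) g(1) f(2,3,4) g(2)] by blast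
  have "x \<noteq> y" "y \<noteq> z" using f assms(3,4) by (auto simp: linked_def)
  then show False using h assms(3,4) by (auto simp: linked_def)
qed

lemma linked_adj:
  assumes "finite V" "adj x y"
  shows "linked V x y"
proof (rule ccontr)
  assume "\<not> linked V x y"
  then obtain f where f: "max_matching V f" "x \<in> unmatched V f" "y \<in> unmatched V f" "x \<noteq> y"
    by (auto simp: linked_def)
  define g where "g = (\<lambda>z. if z = x then y else if z = y then x else f z)"
  have fm: "matching V f" using f by (simp add: max_matching_def)
  have fx: "f x = x" "f y = y" "x \<in> V" "y \<in> V" using f by (auto simp: unmatched_def)
  have *: "f z = x \<longleftrightarrow> z = x" "f z = y \<longleftrightarrow> z = y" for z
    using fx matching_invol[OF fm] by metis+
  have "matching V g"
    unfolding matching_def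
  proof (intro conjI allI impI)
    show "g (g z) = z" for z using fm * by (auto simp: g_def)
    show "z \<in> V" "adj z (g z)" if "g z \<noteq> z" for z
      using that matching_adj[OF fm] matching_inV[OF fm] fx assms(2) adj_sym
      by (auto simp: g_def split: if_splits)
  qed
  moreover have "unmatched V g \<subset> unmatched V f"
    using f by (auto simp: unmatched_def g_def)
  then have "card (unmatched V g) < card (unmatched V f)"
    using assms(1) by (intro psubset_card_mono) (auto simp: unmatched_def)
  ultimately show False using f(1) unfolding max_matching_def by (meson not_le)
qed

end

section \<open>Seagulls\<close>

lemma ex_distinct_representatives:
  assumes "finite I" "\<And>i. i \<in> I \<Longrightarrow> card I \<le> card (N i)"
  shows "\<exists>u. inj_on u I \<and> (\<forall>i\<in>I. u i \<in> N i)"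
  using assms
proof (induction I rule: finite_induct)
  case (insert i I)
  have "card I \<le> card (N j)" if "j \<in> I" for j
    using insert.prems[of j] insert.hyps that by simp
  then obtain u where u: "inj_on u I" "\<forall>j\<in>I. u j \<in> N j"
    using insert.IH by blast
  have "card (u ` I) < card (N i)"
    using insert.prems[of i] insert.hyps card_image_le[of I u] by simp
  then obtain x where "x \<in> N i" "x \<notin> u ` I"
    using insert.hyps by (metis card_mono finite_imageI not_le subsetI)
  then show ?case using u insert.hyps
    by (intro exI[of _ "u(i := x)"]) (auto simp: inj_on_def)
qed simp

lemma ex_distinct_representatives_tight:
  assumes fin: "finite I" and N: "\<And>i. i \<in> I \<Longrightarrow> finite (N i) \<and> card I \<le> Suc (card (N i))"
    and un: "card I \<le> card (\<Union>i\<in>I. N i)"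
  shows "\<exists>u. inj_on u I \<and> (\<forall>i\<in>I. u i \<in> N i)"
proof (cases "I = {}")
  case False
  then obtain i where i: "i \<in> I" by blast
  obtain u where u: "inj_on u (I - {i})" "\<forall>j\<in>I - {i}. u j \<in> N j"
  proof -
    have "card (I - {i}) \<le> card (N j)" if "j \<in> I - {i}" for j
      using N[of j] that card_Diff_singleton[OF i] by auto
    then show ?thesis using ex_distinct_representatives[of "I - {i}" N] fin that by blast
  qed
  have card_u: "card (u ` (I - {i})) = card I - 1" "finite (u ` (I - {i}))"
    using u(1) fin i by (simp_all add: card_image)
  have pos: "card I > 0" using fin i card_gt_0_iff by blast
  show ?thesis
  proof (cases "N i \<subseteq> u ` (I - {i})")
    case False
    then obtain x where "x \<in> N i" "x \<notin> u ` (I - {i})" by blast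
    then show ?thesis using u
      by (intro exI[of _ "u(i := x)"]) (auto simp: inj_on_def)
  next
    case True
    then have eq: "N i = u ` (I - {i})"
      using card_seteq[OF card_u(2) True] N[OF i] card_u(1) by auto
    have "\<not> (\<Union>i\<in>I. N i) \<subseteq> u ` (I - {i})"
      using un card_mono[OF card_u(2), of "\<Union>i\<in>I. N i"] card_u(1) pos by linarith
    then obtain j x where j: "j \<in> I" "x \<in> N j" "x \<notin> u ` (I - {i})" by blast
    then have "j \<noteq> i" using eq by blast
    then show ?thesis using u j eq i
      by (intro exI[of _ "u(j := x, i := u j)"]) (auto simp: inj_on_def)
  qed
qed simp

section \<open>Packings of disjoint seagulls\<close>

locale triangle_P3_K2_free = simple_graph +
  assumes triangle_free: "adj x y \<Longrightarrow> adj y z \<Longrightarrow> \<not> adj x z"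
    and P3_K2_free: "adj a b \<Longrightarrow> adj b c \<Longrightarrow> a \<noteq> c \<Longrightarrow> adj x y \<Longrightarrow>
      \<exists>p\<in>{a, b, c}. \<exists>q\<in>{x, y}. adj p q"
begin

text \<open>
  In the complement of this graph, \<open>a - c - b\<close> is an induced path on three vertices, and
  every further vertex is adjacent to one of its ends \<open>a\<close> and \<open>b\<close>.
\<close>

definition seagull :: "'a \<Rightarrow> 'a \<Rightarrow> 'a \<Rightarrow> bool" where
  "seagull a b c \<longleftrightarrow> adj a b \<and> \<not> adj a c \<and> \<not> adj b c \<and> c \<noteq> a \<and> c \<noteq> b"

text \<open>The set may be any superset of the vertices of the \<open>n\<close> disjoint seagulls,
  which builds in monotonicity.\<close>

inductive packing :: "nat \<Rightarrow> 'a set \<Rightarrow> bool" where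
  packing_0: "packing 0 X"
| packing_Suc: "packing n X \<Longrightarrow> seagull a b c \<Longrightarrow> {a, b, c} \<inter> X = {} \<Longrightarrow> {a, b, c} \<union> X \<subseteq> Y \<Longrightarrow>
    packing (Suc n) Y"

lemma packing_mono: "packing n X \<Longrightarrow> X \<subseteq> Y \<Longrightarrow> packing n Y"
  by (cases rule: packing.cases, assumption) (auto intro: packing.intros)

lemma packing_Un: "packing m X \<Longrightarrow> packing n Y \<Longrightarrow> X \<inter> Y = {} \<Longrightarrow> packing (m + n) (X \<union> Y)"
proof (induction rule: packing.induct)
  case (packing_0 X)
  then show ?case using packing_mono[of n Y] by auto
next
  case (packing_Suc m X a b c Z)
  then have "packing (m + n) (X \<union> Y)" by blast
  then show ?case using packing_Suc.hyps packing_Suc.prems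
    by (auto intro!: packing.packing_Suc[of "m + n" "X \<union> Y" a b c])
qed

definition hits :: "'a \<Rightarrow> 'a set \<Rightarrow> bool" where
  "hits x e \<longleftrightarrow> (\<exists>y\<in>e. adj x y)"

definition touch :: "'a set \<Rightarrow> 'a set \<Rightarrow> bool" where
  "touch e g \<longleftrightarrow> (\<exists>x\<in>e. hits x g)"

lemma touch_sym: "touch e g \<Longrightarrow> touch g e"
  unfolding touch_def hits_def using adj_sym by blast

definition induced_matching :: "'a set set \<Rightarrow> bool" where
  "induced_matching C \<longleftrightarrow> finite C \<and> C \<noteq> {} \<and> (\<forall>e\<in>C. \<exists>x y. e = {x, y} \<and> adj x y) \<and>
     (\<forall>e\<in>C. \<forall>g\<in>C. e \<noteq> g \<longrightarrow> \<not> touch e g)"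

lemma induced_matching_edge:
  assumes "induced_matching C" "e \<in> C"
  shows "\<exists>x y. e = {x, y} \<and> adj x y"
  using assms by (simp add: induced_matching_def)

lemma induced_matching_edge':
  assumes "induced_matching C" "e \<in> C" "x \<in> e"
  shows "\<exists>y. e = {x, y} \<and> adj x y"
  using induced_matching_edge[OF assms(1,2)] assms(3) adj_sym by fastforce

text \<open>
  A vertex \<open>w\<close> of the pool that hits the matching uses up one edge \<open>e\<close> together with the token
  \<open>u\<close>; the remaining end of \<open>e\<close> misses all other edges and becomes the new token.
\<close>

lemma packing_induced_matching:
  assumes "induced_matching C" "finite P" "card C \<le> Suc (card P)"
    "u \<notin> \<Union> C" "u \<notin> P" "P \<inter> \<Union> C = {}" "\<And>e. e \<in> C \<Longrightarrow> \<not> hits u e"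
    "\<And>w. w \<in> P \<Longrightarrow> (\<forall>e\<in>C. hits w e) \<or> (\<forall>e\<in>C. \<not> hits w e)"
  shows "\<exists>Q\<subseteq>P. card C = Suc (card Q) \<and> packing (card C) (\<Union> C \<union> {u} \<union> Q)"
  using assms
proof (induction "card C" arbitrary: C P u)
  case 0
  then show ?case by (auto simp: induced_matching_def)
next
  case (Suc n)
  have finC: "finite C" using Suc.prems by (simp add: induced_matching_def)
  show ?case
  proof (cases n)
    case 0
    then obtain e where C: "C = {e}" using Suc.hyps(2) by (metis card_1_singletonE One_nat_def)
    then obtain x y where e: "e = {x, y}" "adj x y" using Suc.prems(1) by (auto simp: induced_matching_def)
    have "seagull x y u"
      using Suc.prems(4,7) C e adj_sym by (auto simp: seagull_def hits_def)
    then have "packing 1 {x, y, u}"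
      using packing_Suc[OF packing_0[of "{}"], of x y u] by simp
    then show ?thesis using C e by (intro exI[of _ "{}"]) (auto simp: insert_commute)
  next
    case (Suc m)
    then have "card P > 0" using Suc.hyps(2) Suc.prems(3) \<open>Suc n = card C\<close> by linarith
    then obtain w where w: "w \<in> P" by (metis card_gt_0_iff ex_in_conv)
    obtain e where e: "e \<in> C" using Suc.prems(1) by (auto simp: induced_matching_def)
    define C' P' where "C' = C - {e}" and "P' = P - {w}"
    have cards: "card C' = n" "card P = Suc (card P')" "finite P'"
      using e w Suc.prems finC \<open>Suc n = card C\<close> card_Suc_Diff1[of P w] by (auto simp: C'_def P'_def)
    have "C' \<noteq> {}" using cards(1) Suc by auto
    then have C': "induced_matching C'"
      using Suc.prems(1) by (auto simp: induced_matching_def C'_def)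
    have edge: "e \<noteq> g \<Longrightarrow> g \<in> C \<Longrightarrow> \<not> touch e g" for g
      using Suc.prems(1) e by (auto simp: induced_matching_def)
    have disj: "z \<notin> \<Union> C'" if z: "z \<in> e" for z
    proof
      assume "z \<in> \<Union> C'"
      then obtain g where g: "g \<in> C" "g \<noteq> e" "z \<in> g" by (auto simp: C'_def)
      then obtain z' where "z' \<in> g" "adj z z'"
        using induced_matching_edge'[OF Suc.prems(1), of g z] by blast
      then show False using edge[of g] g z by (auto simp: touch_def hits_def)
    qed
    have "\<exists>a b c u'. seagull a b c \<and> {a, b, c} \<inter> (\<Union> C' \<union> {u'} \<union> P') = {} \<and> u' \<notin> \<Union> C' \<union> P' \<and>
        {a, b, c, u'} = insert u (insert w e) \<and> (\<forall>g\<in>C'. \<not> hits u' g)"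
    proof (cases "hits w e")
      case False
      \<comment> \<open>Here \<open>w\<close> itself completes \<open>e\<close> to a seagull, and
        the token \<open>u\<close> is kept.\<close>
      obtain x y where xy: "e = {x, y}" "adj x y"
        using induced_matching_edge[OF Suc.prems(1) e] by blast
      have "seagull x y w"
        using False Suc.prems(6) w e xy adj_sym by (auto simp: seagull_def hits_def)
      moreover have "{x, y, w} \<inter> (\<Union> C' \<union> {u} \<union> P') = {}"
        using disj[of x] disj[of y] xy w e Suc.prems(4,5,6) by (auto simp: C'_def P'_def)
      moreover have "u \<notin> \<Union> C' \<union> P'" "\<forall>g\<in>C'. \<not> hits u g"
        using Suc.prems(4,5,7) by (auto simp: C'_def P'_def)
      moreover have "{x, y, w, u} = insert u (insert w e)" using xy by auto
      ultimately show ?thesis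
        by (intro exI[of _ x] exI[of _ y] exI[of _ w] exI[of _ u]) (intro conjI)
    next
      case True
      then obtain x where x: "x \<in> e" "adj w x" by (auto simp: hits_def)
      then obtain y where y: "e = {x, y}" "adj x y"
        using induced_matching_edge'[OF Suc.prems(1) e] by blast
      have wy: "\<not> adj w y" "\<not> adj y w" using triangle_free[OF x(2) y(2)] adj_sym by blast+
      have ux: "\<not> adj u x" "\<not> adj x u" "\<not> adj u y" "\<not> adj y u"
        using Suc.prems(7)[OF e] y adj_sym by (auto simp: hits_def)
      have ne: "u \<noteq> x" "u \<noteq> y" "u \<noteq> w" "w \<noteq> x" "w \<noteq> y" "x \<noteq> y"
        using Suc.prems(4,5,6) e y w adj_irrefl by auto
      have miss: "\<forall>g\<in>C'. \<not> hits z g" if "z \<in> e" for z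
        using edge that unfolding C'_def touch_def by blast
      have notin: "x \<notin> \<Union> C'" "y \<notin> \<Union> C'" "u \<notin> \<Union> C'" "w \<notin> \<Union> C'" "x \<notin> P" "y \<notin> P" "u \<notin> P"
        using disj y Suc.prems(4,5,6) w e by (auto simp: C'_def)
      \<comment> \<open>The edge \<open>wx\<close> takes \<open>u\<close> as third vertex unless
        \<open>u\<close> and \<open>w\<close> are adjacent; then the edge \<open>uw\<close> takes
        \<open>y\<close>, which misses both of them.\<close>
      show ?thesis
      proof (cases "adj u w")
        case False
        have "seagull w x u"
          using x(2) False ux ne adj_commute[of w u] unfolding seagull_def by blast
        moreover have "\<forall>g\<in>C'. \<not> hits y g" using miss y by blast
        moreover have "{w, x, u, y} = insert u (insert w e)" using y by auto
        moreover have "{w, x, u} \<inter> (\<Union> C' \<union> {y} \<union> P') = {}" "y \<notin> \<Union> C' \<union> P'"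
          using notin ne by (auto simp: P'_def)
        ultimately show ?thesis
          by (intro exI[of _ w] exI[of _ x] exI[of _ u] exI[of _ y]) (intro conjI)
      next
        case True
        have "seagull u w y" using True wy ux ne by (auto simp: seagull_def)
        moreover have "\<forall>g\<in>C'. \<not> hits x g" using miss y by blast
        moreover have "{u, w, y, x} = insert u (insert w e)" using y by auto
        moreover have "{u, w, y} \<inter> (\<Union> C' \<union> {x} \<union> P') = {}" "x \<notin> \<Union> C' \<union> P'"
          using notin ne by (auto simp: P'_def)
        ultimately show ?thesis
          by (intro exI[of _ u] exI[of _ w] exI[of _ y] exI[of _ x]) (intro conjI)
      qed
    qed
    then obtain a b c u' where abc: "seagull a b c" "{a, b, c} \<inter> (\<Union> C' \<union> {u'} \<union> P') = {}"
      and u': "u' \<notin> \<Union> C' \<union> P'" "\<forall>g\<in>C'. \<not> hits u' g"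
      and eq: "{a, b, c, u'} = insert u (insert w e)"
      by (elim exE conjE) (rule that)
    have "\<exists>Q\<subseteq>P'. card C' = Suc (card Q) \<and> packing (card C') (\<Union> C' \<union> {u'} \<union> Q)"
    proof (rule Suc.hyps(1)[of C' P' u'])
      show "n = card C'" "card C' \<le> Suc (card P')" using cards Suc.prems(3) \<open>Suc n = card C\<close> by simp_all
      show "P' \<inter> \<Union> C' = {}" using Suc.prems(6) by (auto simp: P'_def C'_def)
      show "(\<forall>e\<in>C'. hits w e) \<or> (\<forall>e\<in>C'. \<not> hits w e)" if "w \<in> P'" for w
        using Suc.prems(8)[of w] that by (auto simp: P'_def C'_def)
      show "induced_matching C'" "finite P'" by fact+
      show "u' \<notin> \<Union> C'" "u' \<notin> P'" using u'(1) by blast+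
      show "\<not> hits u' g" if "g \<in> C'" for g using u'(2) that by blast
    qed
    then obtain Q where Q: "Q \<subseteq> P'" "card C' = Suc (card Q)" "packing (card C') (\<Union> C' \<union> {u'} \<union> Q)"
      by blast
    have "packing (Suc (card C')) (\<Union> C \<union> {u} \<union> insert w Q)"
    proof (rule packing_Suc[OF Q(3) abc(1)])
      show "{a, b, c} \<inter> (\<Union> C' \<union> {u'} \<union> Q) = {}" using abc(2) Q(1) by blast
      have "insert u (insert w e) \<subseteq> \<Union> C \<union> {u, w}" using e by blast
      then have "{a, b, c, u'} \<subseteq> \<Union> C \<union> {u, w}" unfolding eq .
      then show "{a, b, c} \<union> (\<Union> C' \<union> {u'} \<union> Q) \<subseteq> \<Union> C \<union> {u} \<union> insert w Q"
        by (auto simp: C'_def)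
    qed
    moreover have "card (insert w Q) = Suc (card Q)"
      using Q(1) cards(3) finite_subset[of Q P'] by (subst card_insert_disjoint) (auto simp: P'_def)
    moreover have "insert w Q \<subseteq> P" using Q(1) w by (auto simp: P'_def)
    ultimately show ?thesis using Q(2) cards \<open>Suc n = card C\<close> by (intro exI[of _ "insert w Q"]) auto
  qed
qed

text \<open>With its own token, a matching \<open>C\<close> consumes only \<open>card C - 1\<close>
  vertices of the common pool. The last hypothesis says that the pool covers all these demands, so
  the matchings are served one after another.\<close>

lemma packing_induced_matchings:
  assumes "finite D" "\<And>C. C \<in> D \<Longrightarrow> induced_matching C"
    "\<And>B C. B \<in> D \<Longrightarrow> C \<in> D \<Longrightarrow> B \<noteq> C \<Longrightarrow> \<Union> B \<inter> \<Union> C = {}"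
    "inj_on u D" "\<And>B C. B \<in> D \<Longrightarrow> C \<in> D \<Longrightarrow> u B \<notin> \<Union> C" "\<And>C e. C \<in> D \<Longrightarrow> e \<in> C \<Longrightarrow> \<not> hits (u C) e"
    "finite P" "\<And>C. C \<in> D \<Longrightarrow> P \<inter> \<Union> C = {}" "P \<inter> u ` D = {}"
    "\<And>w C. w \<in> P \<Longrightarrow> C \<in> D \<Longrightarrow> (\<forall>e\<in>C. hits w e) \<or> (\<forall>e\<in>C. \<not> hits w e)"
    "(\<Sum>C\<in>D. card C) \<le> card P + card D"
  shows "packing (\<Sum>C\<in>D. card C) (\<Union> (\<Union> D) \<union> u ` D \<union> P)"
  using assms
proof (induction D arbitrary: P rule: finite_induct)
  case empty
  then show ?case by (simp add: packing_0)
next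
  case (insert C D)
  have pos: "card B \<ge> 1" if "B \<in> insert C D" for B
    using insert.prems(1)[OF that] card_gt_0_iff[of B] unfolding induced_matching_def by linarith
  have "card D = (\<Sum>B\<in>D. 1)" by simp
  also have "\<dots> \<le> (\<Sum>B\<in>D. card B)" using pos by (intro sum_mono) auto
  finally have le: "card C \<le> Suc (card P)" using insert.prems(10) insert.hyps by simp
  obtain Q where Q: "Q \<subseteq> P" "card C = Suc (card Q)" "packing (card C) (\<Union> C \<union> {u C} \<union> Q)"
  proof -
    have "\<exists>Q\<subseteq>P. card C = Suc (card Q) \<and> packing (card C) (\<Union> C \<union> {u C} \<union> Q)"
    proof (rule packing_induced_matching)
      show "induced_matching C" using insert.prems(1) by blast
      show "finite P" "card C \<le> Suc (card P)" by fact+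
      show "u C \<notin> \<Union> C" using insert.prems(4) by blast
      show "u C \<notin> P" using insert.prems(8) by auto
      show "P \<inter> \<Union> C = {}" using insert.prems(7) by blast
      show "\<not> hits (u C) e" if "e \<in> C" for e using insert.prems(5) that by blast
      show "(\<forall>e\<in>C. hits w e) \<or> (\<forall>e\<in>C. \<not> hits w e)" if "w \<in> P" for w
        using insert.prems(9) that by blast
    qed
    then show ?thesis using that by blast
  qed
  have finQ: "finite Q" using Q(1) insert.prems(6) finite_subset by blast
  have "packing (\<Sum>C\<in>D. card C) (\<Union> (\<Union> D) \<union> u ` D \<union> (P - Q))"
  proof (rule insert.IH)
    show "(\<Sum>C\<in>D. card C) \<le> card (P - Q) + card D"
      using insert.prems(10) insert.hyps Q card_Diff_subset[OF finQ Q(1)] card_mono[OF insert.prems(6) Q(1)]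
      by simp
    show "inj_on u D" using insert.prems(3) by simp
    show "(P - Q) \<inter> \<Union> B = {}" if "B \<in> D" for B using insert.prems(7)[of B] that by auto
    show "(P - Q) \<inter> u ` D = {}" using insert.prems(8) by auto
    show "(\<forall>e\<in>B. hits w e) \<or> (\<forall>e\<in>B. \<not> hits w e)" if "w \<in> P - Q" "B \<in> D" for w B
      using insert.prems(9)[of w B] that by auto
    show "induced_matching B" if "B \<in> D" for B
      using insert.prems(1) that by blast
    show "\<Union> A \<inter> \<Union> B = {}" if "A \<in> D" "B \<in> D" "A \<noteq> B" for A B
      using insert.prems(2)[of A B] that by blast
    show "u A \<notin> \<Union> B" if "A \<in> D" "B \<in> D" for A B
      using insert.prems(4)[of A B] that by blast
    show "\<not> hits (u B) e" if "B \<in> D" "e \<in> B" for B e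
      using insert.prems(5)[of B e] that by blast
    show "finite (P - Q)" using insert.prems(6) by blast
  qed
  moreover have "(\<Union> C \<union> {u C} \<union> Q) \<inter> (\<Union> (\<Union> D) \<union> u ` D \<union> (P - Q)) = {}"
  proof -
    have "\<Union> C \<inter> \<Union> (\<Union> D) = {}" using insert.prems(2)[of C] insert.hyps by blast
    moreover have "\<Union> C \<inter> u ` D = {}" using insert.prems(4) by blast
    moreover have "\<Union> C \<inter> P = {}" using insert.prems(7)[of C] by blast
    moreover have "u C \<notin> \<Union> (\<Union> D)" using insert.prems(4) by blast
    moreover have "u C \<notin> u ` D" using insert.prems(3) insert.hyps by simp
    moreover have "u C \<notin> P" "P \<inter> u ` D = {}" using insert.prems(8) by auto
    moreover have "P \<inter> \<Union> (\<Union> D) = {}" using insert.prems(7) by blast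
    moreover have "(X \<union> {a} \<union> Q) \<inter> (Y \<union> Z \<union> (P - Q)) = {}"
      if "X \<inter> Y = {}" "X \<inter> Z = {}" "X \<inter> P = {}" "a \<notin> Y" "a \<notin> Z" "a \<notin> P" "P \<inter> Z = {}" "P \<inter> Y = {}"
      for X Y Z a using that Q(1) by blast
    ultimately show ?thesis by presburger
  qed
  ultimately have "packing (card C + (\<Sum>C\<in>D. card C))
      ((\<Union> C \<union> {u C} \<union> Q) \<union> (\<Union> (\<Union> D) \<union> u ` D \<union> (P - Q)))"
    using packing_Un[OF Q(3)] by blast
  moreover have "(\<Union> C \<union> {u C} \<union> Q) \<union> (\<Union> (\<Union> D) \<union> u ` D \<union> (P - Q)) \<subseteq> \<Union> (\<Union> (insert C D)) \<union> u ` insert C D \<union> P"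
    using Q(1) by auto
  ultimately show ?case
    unfolding sum.insert[OF insert.hyps] by (rule packing_mono)
qed

end

section \<open>Factor-critical graphs\<close>

text \<open>
  Since the neighbourhood \<open>A\<close> of \<open>v\<close> is independent, \<open>f\<close> maps \<open>A - {a0}\<close> to a set \<open>W\<close> outside
  of \<open>A\<close>, and it restricts to a perfect matching \<open>M\<close> of the remaining vertices \<open>U\<close>.
\<close>

locale near_perfect = triangle_P3_K2_free +
  fixes V :: "'a set" and k :: nat and v a0 :: 'a and f :: "'a \<Rightarrow> 'a"
  assumes finV: "finite V" and cardV: "card V = 2 * k + 1"
    and vV: "v \<in> V"
    and maxdeg: "\<And>x. x \<in> V \<Longrightarrow> card {y \<in> V. adj x y} \<le> card {y \<in> V. adj v y}"
    and deg2: "\<And>x. x \<in> V \<Longrightarrow> 2 \<le> card {y \<in> V. adj x y}"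
    and a0: "a0 \<in> V" "adj v a0"
    and fm: "matching V f" and fu: "unmatched V f = {a0}"
    and small: "card {y \<in> V. adj v y} \<le> k"
begin

definition A where "A = {y \<in> V. adj v y}"
definition R where "R = V - A"
definition W where "W = f ` (A - {a0})"
definition U where "U = R - W"
text \<open>The number of seagulls needed besides the independent set \<open>A\<close> to reach the
  order \<open>k + 1\<close>. The subtraction is not truncated, since \<open>card A\<close> is at
  most \<open>k\<close>.\<close>

definition s where "s = k + 1 - card A"
definition M where "M = (\<lambda>x. {x, f x}) ` U"
definition nbA where "nbA x = {a \<in> A. adj x a}"
definition nbR where "nbR x = {y \<in> R. adj x y}"

lemma ff [simp]: "f (f x) = x"
  using fm by simp

lemma fV: "x \<in> V \<Longrightarrow> f x \<in> V"
  using matching_in[OF fm] .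

lemma fix_iff: "x \<in> V \<Longrightarrow> f x = x \<longleftrightarrow> x = a0"
  using fu by (auto simp: unmatched_def)

lemma adj_f: "x \<in> V \<Longrightarrow> x \<noteq> a0 \<Longrightarrow> adj x (f x)"
  using matching_adj[OF fm] fix_iff by blast

lemma finite_sets: "finite A" "finite R" "finite W" "finite U" "finite (nbA x)" "finite (nbR x)" "finite M"
  using finV by (auto simp: A_def R_def W_def U_def M_def nbA_def nbR_def)

lemma A_indep: "x \<in> A \<Longrightarrow> y \<in> A \<Longrightarrow> \<not> adj x y"
  using triangle_free[of x v y] adj_sym by (auto simp: A_def)

lemma a0A: "a0 \<in> A" and v_notin_A: "v \<notin> A"
  using a0 adj_irrefl by (auto simp: A_def)

lemma fA: "a \<in> A \<Longrightarrow> a \<noteq> a0 \<Longrightarrow> f a \<in> R"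
  using adj_f[of a] fV[of a] A_indep[of a "f a"] by (auto simp: R_def A_def)

lemma W_subset: "W \<subseteq> R"
  using fA by (auto simp: W_def)

lemma vR: "v \<in> R"
  using vV v_notin_A by (auto simp: R_def)

lemma not_adj_v: "x \<in> R \<Longrightarrow> \<not> adj v x" "x \<in> R \<Longrightarrow> \<not> adj x v"
  using adj_sym by (auto simp: R_def A_def)

lemma vW: "v \<in> W"
proof -
  have "v \<noteq> a0" using a0 adj_irrefl by auto
  then have "adj v (f v)" "f v \<in> V" using adj_f[OF vV] fV[OF vV] by auto
  moreover have "f v \<noteq> a0"
    using \<open>v \<noteq> a0\<close> fix_iff[of a0] a0 by (metis ff)
  ultimately have "f v \<in> A - {a0}" by (simp add: A_def)
  then show ?thesis unfolding W_def by (metis ff imageI)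
qed

lemma card_A: "2 \<le> card A" "card A \<le> k"
  using deg2[OF vV] small by (simp_all add: A_def)

lemma card_W: "card W = card A - 1"
proof -
  have "inj_on f (A - {a0})" by (metis ff inj_onI)
  then show ?thesis using a0A finite_sets by (simp add: W_def card_image)
qed

lemma U_props: "x \<in> U \<Longrightarrow> x \<in> R \<and> x \<notin> W \<and> x \<noteq> v \<and> x \<in> V \<and> x \<notin> A"
  using vW by (auto simp: U_def R_def)

lemma fU: assumes "x \<in> U" shows "f x \<in> U" "adj x (f x)" "f x \<noteq> x"
proof -
  have x: "x \<in> V" "x \<notin> A" "x \<notin> W" using U_props[OF assms] by auto
  then have "x \<noteq> a0" using a0A by auto
  then show "adj x (f x)" "f x \<noteq> x" using adj_f x fix_iff by auto
  have "f x \<notin> A"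
  proof
    assume "f x \<in> A"
    moreover have "f x \<noteq> a0" using \<open>x \<noteq> a0\<close> fix_iff[of a0] a0 by (metis ff)
    ultimately show False using x(3) unfolding W_def by (metis ff imageI insertE Diff_iff singletonD)
  qed
  moreover have "f x \<notin> W"
  proof
    assume "f x \<in> W"
    then obtain a where "a \<in> A" "f x = f a" by (auto simp: W_def)
    then show False using x(2) by (metis ff)
  qed
  ultimately show "f x \<in> U" using fV x(1) by (auto simp: U_def R_def)
qed

lemma card_R: "card R = 2 * k + 1 - card A"
proof -
  have "A \<subseteq> V" by (auto simp: A_def)
  then show ?thesis using finite_sets(1) by (simp add: R_def card_Diff_subset cardV)
qed

lemma card_U: "card U = 2 * s"
  using card_Diff_subset[OF finite_sets(3) W_subset] card_R card_W card_A
  unfolding U_def s_def by linarith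

lemma card_M: "card M = s"
proof -
  have "2 * card M = card U + card {x \<in> U. f x = x}"
    unfolding M_def by (rule card_involution_classes) (use finite_sets fU in auto)
  moreover have "{x \<in> U. f x = x} = {}" using fU by auto
  ultimately show ?thesis using card_U by simp
qed

section \<open>Degree bounds outside of \<open>A\<close>\<close>

lemma card_nb: "x \<in> R \<Longrightarrow> card (nbA x) + card (nbR x) \<le> card A"
proof -
  assume x: "x \<in> R"
  have "card (nbA x) + card (nbR x) = card (nbA x \<union> nbR x)"
    using finite_sets by (subst card_Un_disjoint) (auto simp: nbA_def nbR_def R_def)
  also have "nbA x \<union> nbR x = {y \<in> V. adj x y}"
    by (auto simp: nbA_def nbR_def R_def A_def)
  finally show ?thesis using maxdeg[of x] x by (simp add: A_def R_def)
qed

text \<open>Two vertices of \<open>A\<close> that both miss the edge \<open>xy\<close> would form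
  with \<open>v\<close> a path without neighbours on \<open>xy\<close>, because \<open>v\<close> has
  no neighbour in \<open>R\<close>. So at most one vertex of \<open>A\<close> misses it.\<close>

lemma edge_nbA:
  assumes "x \<in> R" "y \<in> R" "adj x y"
  shows "card A \<le> Suc (card (nbA x) + card (nbA y))"
proof -
  let ?Z = "A - (nbA x \<union> nbA y)"
  have "card ?Z \<le> Suc 0"
  proof (subst card_le_Suc0_iff_eq)
    show "\<forall>a\<in>?Z. \<forall>b\<in>?Z. a = b"
    proof (intro ballI, rule ccontr)
      fix a b assume ab: "a \<in> ?Z" "b \<in> ?Z" "a \<noteq> b"
      then have "adj a v" "adj v b" using adj_sym by (auto simp: A_def)
      then obtain p q where "p \<in> {a, v, b}" "q \<in> {x, y}" "adj p q"
        using P3_K2_free[OF _ _ ab(3) assms(3)] by blast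
      then show False using ab not_adj_v assms(1,2) adj_sym by (auto simp: nbA_def)
    qed
  qed (use finite_sets in auto)
  moreover have "card A \<le> card (?Z \<union> nbA x \<union> nbA y)"
    using finite_sets by (intro card_mono) auto
  moreover have "card (?Z \<union> nbA x \<union> nbA y) \<le> card ?Z + card (nbA x) + card (nbA y)"
    using card_Un_le[of "?Z \<union> nbA x" "nbA y"] card_Un_le[of ?Z "nbA x"] by linarith
  ultimately show ?thesis by linarith
qed

lemma edge_nbR:
  assumes "x \<in> R" "y \<in> R" "adj x y"
  shows "card (nbR x) + card (nbR y) \<le> Suc (card A)"
  using edge_nbA[OF assms] card_nb[OF assms(1)] card_nb[OF assms(2)] by linarith

text \<open>Double counting of the edges between \<open>A\<close> and \<open>R - {v}\<close>: a
  vertex of \<open>A\<close> has degree at most \<open>card A\<close>, and one of its neighbours is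
  \<open>v\<close>.\<close>

lemma sum_nbA_le: "(\<Sum>x\<in>R - {v}. card (nbA x)) \<le> card A * (card A - 1)"
proof -
  have "(\<Sum>x\<in>R - {v}. card (nbA x)) = (\<Sum>x\<in>R - {v}. \<Sum>a\<in>A. if adj x a then 1 else 0)"
    using finite_sets by (simp add: nbA_def sum.If_cases Int_def)
  also have "\<dots> = (\<Sum>a\<in>A. \<Sum>x\<in>R - {v}. if adj x a then 1 else 0)"
    by (rule sum.swap)
  also have "\<dots> = (\<Sum>a\<in>A. card {x \<in> R - {v}. adj x a})"
    using finite_sets by (simp add: sum.If_cases Int_def)
  also have "\<dots> \<le> (\<Sum>a\<in>A. card A - 1)"
  proof (rule sum_mono)
    fix a assume a: "a \<in> A"
    have "{x \<in> R - {v}. adj x a} \<subseteq> {y \<in> V. adj a y} - {v}"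
      using adj_sym by (auto simp: R_def)
    then have "card {x \<in> R - {v}. adj x a} \<le> card ({y \<in> V. adj a y} - {v})"
      using finV by (intro card_mono) auto
    also have "\<dots> = card {y \<in> V. adj a y} - 1"
      using a vV adj_sym finV by (subst card_Diff_singleton) (auto simp: A_def)
    also have "\<dots> \<le> card A - 1"
      using maxdeg[of a] a by (auto simp: A_def intro: diff_le_mono)
    finally show "card {x \<in> R - {v}. adj x a} \<le> card A - 1" .
  qed
  finally show ?thesis by simp
qed

text \<open>This is \<open>edge_nbA\<close> for the pairs of \<open>M\<close>; reindexing with the
  involution \<open>f\<close> turns the sum over pairs into twice the sum over
  \<open>U\<close>.\<close>

lemma sum_nbA_U: "s * (card A - 1) \<le> (\<Sum>x\<in>U. card (nbA x))"
proof -
  have "2 * s * (card A - 1) = (\<Sum>x\<in>U. card A - 1)" using card_U by simp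
  also have "\<dots> \<le> (\<Sum>x\<in>U. card (nbA x) + card (nbA (f x)))"
  proof (rule sum_mono)
    fix x assume x: "x \<in> U"
    show "card A - 1 \<le> card (nbA x) + card (nbA (f x))"
      using edge_nbA[of x "f x"] fU[OF x] U_props[OF x] U_props[of "f x"] by simp
  qed
  also have "\<dots> = (\<Sum>x\<in>U. card (nbA x)) + (\<Sum>x\<in>U. card (nbA (f x)))"
    by (rule sum.distrib)
  also have "(\<Sum>x\<in>U. card (nbA (f x))) = (\<Sum>x\<in>U. card (nbA x))"
    by (rule sum.reindex_bij_witness[of _ f f]) (use fU in auto)
  finally show ?thesis by simp
qed

text \<open>
  Otherwise the \<open>s\<close> edges of \<open>M\<close> already take up all edges between \<open>A\<close> and \<open>R - {v}\<close>, and a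
  vertex of \<open>R - {v}\<close> without neighbours in \<open>A\<close> would have a neighbour of too large degree.
\<close>

lemma s_less: "s < card A"
proof (rule ccontr)
  assume "\<not> s < card A"
  then have s: "card A \<le> s" by simp
  have split: "(\<Sum>x\<in>R - {v}. card (nbA x)) = (\<Sum>x\<in>U. card (nbA x)) + (\<Sum>x\<in>W - {v}. card (nbA x))"
  proof -
    have "R - {v} = U \<union> (W - {v})" using W_subset vW by (auto simp: U_def)
    moreover have "U \<inter> (W - {v}) = {}" by (auto simp: U_def)
    ultimately show ?thesis using finite_sets(3,4) by (simp add: sum.union_disjoint)
  qed
  have "card A * (card A - 1) \<le> s * (card A - 1)" using s by (rule mult_le_mono1)
  then have zero: "(\<Sum>x\<in>W - {v}. card (nbA x)) = 0" and
    top: "(\<Sum>x\<in>U. card (nbA x)) \<le> card A * (card A - 1)"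
    using sum_nbA_le sum_nbA_U split by linarith+
  have W0: "nbA y = {}" if "y \<in> W - {v}" for y
    using zero that finite_sets by simp
  have pos: "nbA x \<noteq> {}" if x: "x \<in> R - {v}" for x
  proof
    assume empty: "nbA x = {}"
    have "\<not> {y \<in> V. adj x y} \<subseteq> {f x}"
      using deg2[of x] x card_mono[of "{f x}" "{y \<in> V. adj x y}"] by (auto simp: R_def)
    then obtain y where y: "y \<in> V" "adj x y" "y \<noteq> f x" by blast
    have yR: "y \<in> R" "y \<noteq> v" using y empty x not_adj_v by (auto simp: nbA_def R_def)
    have c: "card A \<le> Suc (card (nbA y))"
      using edge_nbA[of x y] x yR y empty by simp
    then have "nbA y \<noteq> {}" using card_A by auto
    then have yU: "y \<in> U" using W0 yR by (auto simp: U_def)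
    \<comment> \<open>With at least \<open>card A - 1\<close> neighbours in \<open>A\<close> and now
      two in \<open>R\<close>, the vertex \<open>y\<close> exceeds the maximum degree.\<close>
    have "{x, f y} \<subseteq> nbR y" "f y \<noteq> x"
      using x y fU[OF yU] U_props[of "f y"] adj_sym by (auto simp: nbR_def)
    then have "2 \<le> card (nbR y)"
      using card_mono[OF finite_sets(6), of "{x, f y}" y] by auto
    then show False using c card_nb[OF yR(1)] by linarith
  qed
  \<comment> \<open>By \<open>W0\<close> and \<open>pos\<close>, \<open>W\<close> is just
    \<open>{v}\<close>, hence \<open>card A = 2\<close>. Then the \<open>2 * s\<close> vertices of
    \<open>U\<close>, at least four, each need a neighbour in \<open>A\<close>, but
    \<open>top\<close> leaves room for only two such edges.\<close>
  then have "W - {v} = {}" using W0 W_subset by blast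
  then have "card W \<le> 1" using card_mono[of "{v}" W] by auto
  then have A2: "card A = 2" using card_W card_A by linarith
  have "(\<Sum>x\<in>U. 1) \<le> (\<Sum>x\<in>U. card (nbA x))"
  proof (rule sum_mono)
    fix x assume "x \<in> U"
    then have "nbA x \<noteq> {}" using pos U_props by blast
    then show "1 \<le> card (nbA x)" using finite_sets by (simp add: Suc_le_eq card_gt_0_iff)
  qed
  then show False using top card_U s A2 by simp
qed

lemma M_edge: assumes "e \<in> M" "x \<in> e" shows "e = {x, f x}" "x \<in> U"
  using assms fU(1) by (auto simp: M_def)

lemma M_ne: "e \<in> M \<Longrightarrow> \<exists>x. x \<in> e"
  by (auto simp: M_def)

lemma M_disjoint: "e \<in> M \<Longrightarrow> g \<in> M \<Longrightarrow> x \<in> e \<Longrightarrow> x \<in> g \<Longrightarrow> e = g"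
  using M_edge by blast

section \<open>Vertices of \<open>W\<close> that miss an edge of \<open>M\<close>\<close>

definition N where "N e = {w \<in> W. \<not> hits w e}"

text \<open>The edge \<open>e\<close>, the vertices of \<open>W\<close> that hit it and the set
  \<open>Y\<close> are disjoint and consist of neighbours of the two ends of \<open>e\<close>, of
  which \<open>R\<close> contains at most \<open>card A + 1\<close>. Subtracting the two ends and
  using \<open>card W = card A - 1\<close> leaves the bound.\<close>

lemma hit_count:
  assumes e: "e \<in> M" and Y: "Y \<subseteq> U - e" "\<And>y. y \<in> Y \<Longrightarrow> hits y e"
  shows "card Y \<le> card (N e)"
proof -
  obtain x where "x \<in> e" using M_ne[OF e] by blast
  then have e': "e = {x, f x}" and x: "x \<in> U" using M_edge[OF e] by auto
  have disj: "nbR x \<inter> nbR (f x) = {}"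
    using triangle_free[OF fU(2)[OF x]] by (auto simp: nbR_def)
  have finY: "finite Y" using Y(1) finite_sets by (meson finite_Diff finite_subset)
  have nb: "y \<in> nbR x \<union> nbR (f x)" if "hits y e" "y \<in> R" for y
    using that adj_commute unfolding nbR_def hits_def e' by blast
  have "e \<subseteq> nbR x \<union> nbR (f x)"
    using fU[OF x] U_props[OF x] U_props[of "f x"] adj_sym by (auto simp: e' nbR_def)
  moreover have "W - N e \<subseteq> nbR x \<union> nbR (f x)"
    using nb W_subset unfolding N_def by blast
  moreover have "Y \<subseteq> nbR x \<union> nbR (f x)"
    using nb Y U_props by blast
  ultimately have sub: "e \<union> (W - N e) \<union> Y \<subseteq> nbR x \<union> nbR (f x)"
    by blast
  have "card (e \<union> (W - N e) \<union> Y) \<le> card (nbR x \<union> nbR (f x))"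
    using finite_sets by (intro card_mono sub) auto
  also have "\<dots> = card (nbR x) + card (nbR (f x))"
    using finite_sets disj by (intro card_Un_disjoint) auto
  also have "\<dots> \<le> Suc (card A)"
    using edge_nbR[of x "f x"] fU[OF x] U_props[OF x] U_props[of "f x"] by simp
  finally have 1: "card (e \<union> (W - N e) \<union> Y) \<le> Suc (card A)" .
  have "card (e \<union> (W - N e) \<union> Y) = card (e \<union> (W - N e)) + card Y"
    using finY finite_sets Y(1) e' U_props by (intro card_Un_disjoint) auto
  also have "card (e \<union> (W - N e)) = card e + card (W - N e)"
    using finite_sets e' x fU(1)[OF x] U_props by (intro card_Un_disjoint) auto
  also have "card e = 2" using e' fU(3)[OF x] by auto
  also have "card (W - N e) = card W - card (N e)"
    using finite_sets by (intro card_Diff_subset) (auto simp: N_def)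
  finally have "card (e \<union> (W - N e) \<union> Y) = 2 + (card W - card (N e)) + card Y" .
  moreover have "card (N e) \<le> card W"
    using finite_sets by (intro card_mono) (auto simp: N_def)
  ultimately show ?thesis using 1 card_W card_A by linarith
qed

text \<open>Each edge of \<open>D\<close> has an end that hits \<open>e\<close>, and disjoint edges
  give different ends. The result is a set \<open>Y\<close> as in \<open>hit_count\<close>.\<close>

lemma transversal_count:
  assumes e: "e \<in> M" and D: "D \<subseteq> M - {e}" "\<And>g. g \<in> D \<Longrightarrow> touch e g"
  shows "\<exists>Y. Y \<subseteq> U \<inter> \<Union> D \<and> card Y = card D \<and> (\<forall>y\<in>Y. hits y e)"
proof -
  have "\<forall>g\<in>D. \<exists>y\<in>g. hits y e"
    using D(2) touch_sym unfolding touch_def by blast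
  then obtain h where h: "\<And>g. g \<in> D \<Longrightarrow> h g \<in> g \<and> hits (h g) e" by metis
  have "inj_on h D"
  proof (rule inj_onI)
    fix g g' assume g: "g \<in> D" "g' \<in> D" "h g = h g'"
    then have "h g \<in> g" "h g \<in> g'" using h[of g] h[of g'] by auto
    then show "g = g'" using g(1,2) D(1) M_disjoint[of g g'] by blast
  qed
  then have "card (h ` D) = card D" by (rule card_image)
  moreover have "h ` D \<subseteq> U \<inter> \<Union> D"
  proof
    fix y assume "y \<in> h ` D"
    then obtain g where g: "g \<in> D" "y = h g" by blast
    then have "y \<in> g" "g \<in> M" using h D(1) by auto
    then show "y \<in> U \<inter> \<Union> D" using M_edge(2) g(1) by blast
  qed
  moreover have "\<forall>y\<in>h ` D. hits y e" using h by blast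
  ultimately show ?thesis by blast
qed

lemma M_induced:
  assumes "C \<subseteq> M" "C \<noteq> {}" "\<And>e g. e \<in> C \<Longrightarrow> g \<in> C \<Longrightarrow> e \<noteq> g \<Longrightarrow> \<not> touch e g"
  shows "induced_matching C"
proof -
  have "\<exists>x y. e = {x, y} \<and> adj x y" if "e \<in> C" for e
  proof -
    obtain x where "x \<in> U" "e = {x, f x}" using assms(1) \<open>e \<in> C\<close> unfolding M_def by blast
    then show ?thesis using fU(2) by blast
  qed
  moreover have "finite C" using assms(1) finite_sets(7) finite_subset by blast
  ultimately show ?thesis using assms(2,3) by (simp add: induced_matching_def)
qed

text \<open>If \<open>x\<close> is the end of \<open>e\<close> adjacent to \<open>w\<close>, then
  \<open>f x\<close>, \<open>x\<close>, \<open>w\<close> is a path, so one of its vertices is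
  adjacent to an end of \<open>g\<close>. As \<open>e\<close> does not touch \<open>g\<close>, this
  vertex is \<open>w\<close>.\<close>

lemma hits_near:
  assumes e: "e \<in> M" and g: "g \<in> M" and "\<not> touch e g" and w: "w \<notin> e" "hits w e"
  shows "hits w g"
proof -
  obtain x where x: "x \<in> e" "adj w x" using w(2) by (auto simp: hits_def)
  obtain y where "y \<in> g" using M_ne[OF g] by blast
  then have g': "g = {y, f y}" "adj y (f y)" using M_edge[OF g] fU by auto
  have e': "e = {x, f x}" "adj (f x) x" using M_edge[OF e x(1)] fU adj_sym by auto
  then have "f x \<noteq> w" using w(1) by auto
  then obtain p q where pq: "p \<in> {f x, x, w}" "q \<in> {y, f y}" "adj p q"
    using P3_K2_free[OF e'(2) adj_sym[OF x(2)] _ g'(2)] by blast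
  then have "p \<notin> e" using assms(3) g' unfolding touch_def hits_def by blast
  then show ?thesis using pq g' e' by (auto simp: hits_def)
qed

lemma near_trans:
  assumes "e \<in> M" "g \<in> M" "h \<in> M" "\<not> touch e g" "\<not> touch g h" "e \<noteq> h"
  shows "\<not> touch e h"
proof
  assume "touch e h"
  then obtain w where w: "w \<in> h" "hits w e" using touch_sym unfolding touch_def by blast
  then have "w \<notin> e" using M_disjoint[of e h w] assms(1,3,6) by blast
  then have "hits w g" using hits_near assms(1,2,4) w(2) by blast
  then show False using assms(5) w(1) touch_sym unfolding touch_def by blast
qed

text \<open>
  Being equal or not touching is an equivalence relation on \<open>M\<close>, and every other vertex hits all edges
  of a class or none.
\<close>

definition cls where "cls e = {g \<in> M. e = g \<or> \<not> touch e g}"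
definition Cs where "Cs = cls ` M"
definition NC where "NC C = {w \<in> W. \<forall>e\<in>C. \<not> hits w e}"

lemma cls_eq:
  assumes "e \<in> M" "g \<in> cls e"
  shows "cls g = cls e"
proof -
  have sub: "cls b \<subseteq> cls a" if "a \<in> M" "b \<in> cls a" for a b
    using near_trans[of a b] that unfolding cls_def by blast
  have "g \<in> M" "e \<in> cls g" using assms touch_sym by (auto simp: cls_def)
  then show ?thesis using sub assms by blast
qed

lemma Cs_subset: "C \<in> Cs \<Longrightarrow> C \<subseteq> M"
  by (auto simp: Cs_def cls_def)

lemma Cs_cls:
  assumes "C \<in> Cs" "e \<in> C"
  shows "C = cls e"
proof -
  obtain g where "g \<in> M" "C = cls g" using assms(1) unfolding Cs_def by blast
  then show ?thesis using cls_eq[of g e] assms(2) by simp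
qed

lemma Cs_disjoint: "B \<in> Cs \<Longrightarrow> C \<in> Cs \<Longrightarrow> e \<in> B \<Longrightarrow> e \<in> C \<Longrightarrow> B = C"
  using Cs_cls[of B e] Cs_cls[of C e] by simp

lemma Cs_ne: "C \<in> Cs \<Longrightarrow> C \<noteq> {}"
  by (auto simp: Cs_def cls_def)

lemma Union_Cs: "\<Union> Cs = M"
  by (auto simp: Cs_def cls_def)

lemma finite_Cs: "finite Cs"
  using finite_sets(7) by (simp add: Cs_def)

lemma finite_Cs_elem: "C \<in> Cs \<Longrightarrow> finite C"
  using Cs_subset finite_sets(7) by (rule finite_subset)

lemma Cs_induced: "C \<in> Cs \<Longrightarrow> induced_matching C"
proof (rule M_induced)
  fix e g assume "C \<in> Cs" "e \<in> C" "g \<in> C" "e \<noteq> g"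
  then have "g \<in> cls e" using Cs_cls by blast
  then show "\<not> touch e g" using \<open>e \<noteq> g\<close> by (auto simp: cls_def)
qed (use Cs_subset Cs_ne in auto)

lemma sum_Cs: "(\<Sum>C\<in>Cs. card C) = s"
proof -
  have "card (\<Union> Cs) = (\<Sum>C\<in>Cs. card C)"
    using Cs_disjoint finite_Cs_elem by (intro card_Union_disjoint) (auto simp: pairwise_def disjnt_def)
  then show ?thesis using Union_Cs card_M by simp
qed

text \<open>By \<open>hits_near\<close>, a vertex of \<open>W\<close> that hits one edge of a class
  hits all of them, so the vertices that miss an edge depend only on its class.\<close>

lemma N_eq_NC: assumes "C \<in> Cs" "e \<in> C" shows "N e = NC C"
proof -
  have "hits w e" if "w \<in> W" "g \<in> C" "hits w g" for w g
  proof (cases "g = e")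
    case False
    have g: "g \<in> M" "e \<in> M" "\<not> touch g e"
      using Cs_cls[OF assms(1) that(2)] assms Cs_subset that(2) False unfolding cls_def by auto
    have "w \<notin> g" using M_edge(2)[OF g(1)] that(1) by (auto simp: U_def)
    then show ?thesis using hits_near[OF g] that(3) by blast
  qed (use that in simp)
  then show ?thesis using assms(2) by (auto simp: N_def NC_def)
qed

lemma card_others: assumes "C \<in> Cs" shows "s - card C = (\<Sum>D\<in>Cs - {C}. card D)"
  using sum.remove[OF finite_Cs assms, of card] sum_Cs by simp

lemma card_Cs_pos: "C \<in> Cs \<Longrightarrow> 1 \<le> card C"
  using finite_Cs_elem Cs_ne by (simp add: Suc_le_eq card_gt_0_iff)

text \<open>All \<open>s - card C\<close> edges outside of the class touch a fixed edge
  \<open>e\<close> of \<open>C\<close>, so \<open>transversal_count\<close> supplies a set of this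
  size for \<open>hit_count\<close>.\<close>

lemma card_NC_ge: assumes C: "C \<in> Cs" shows "s - card C \<le> card (NC C)"
proof -
  obtain e where e: "e \<in> C" using Cs_ne[OF C] by blast
  then have eM: "e \<in> M" using Cs_subset C by blast
  have "\<exists>Y. Y \<subseteq> U \<inter> \<Union> (M - C) \<and> card Y = card (M - C) \<and> (\<forall>y\<in>Y. hits y e)"
    using e Cs_cls[OF C e] by (intro transversal_count[OF eM]) (auto simp: cls_def)
  then obtain Y where Y: "Y \<subseteq> U \<inter> \<Union> (M - C)" "card Y = card (M - C)" "\<forall>y\<in>Y. hits y e" by blast
  have "Y \<subseteq> U - e" using Y(1) M_disjoint[OF eM] e by blast
  then have "card Y \<le> card (N e)" using hit_count[OF eM] Y(3) by blast
  moreover have "card Y = s - card C"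
    unfolding Y(2) card_Diff_subset[OF finite_Cs_elem[OF C] Cs_subset[OF C]] card_M ..
  ultimately show ?thesis unfolding N_eq_NC[OF C e] by simp
qed

text \<open>Every other class has at least one edge. With \<open>card_NC_ge\<close>, the sets
  \<open>NC C\<close> are at most one element short of \<open>card Cs\<close>, as
  \<open>ex_distinct_representatives_tight\<close> allows.\<close>

lemma card_Cs_le:
  assumes C: "C \<in> Cs"
  shows "card Cs - 1 \<le> s - card C"
proof -
  have "card Cs - 1 = (\<Sum>D\<in>Cs - {C}. 1)" using C finite_Cs by simp
  also have "\<dots> \<le> (\<Sum>D\<in>Cs - {C}. card D)" by (intro sum_mono card_Cs_pos) blast
  finally show ?thesis unfolding card_others[OF C] .
qed

lemma Union_M_subset: "\<Union> M \<subseteq> U"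
  using M_edge(2) by blast

text \<open>The classes are induced matchings. The representative of a class is its token, and the
  rest of \<open>W\<close> is the common pool.\<close>

lemma packing_if_representatives:
  assumes u: "inj_on u Cs" "\<forall>C\<in>Cs. u C \<in> NC C"
  shows "packing s R"
proof -
  have uW: "u ` Cs \<subseteq> W" using u(2) by (auto simp: NC_def)
  have UW: "U \<inter> W = {}" by (auto simp: U_def)
  have CU: "\<Union> C \<subseteq> U" if "C \<in> Cs" for C
    using Union_mono[OF Cs_subset[OF that]] Union_M_subset by (rule order_trans)
  have "packing (\<Sum>C\<in>Cs. card C) (\<Union> (\<Union> Cs) \<union> u ` Cs \<union> (W - u ` Cs))"
  proof (rule packing_induced_matchings)
    show "\<Union> B \<inter> \<Union> C = {}" if BC: "B \<in> Cs" "C \<in> Cs" "B \<noteq> C" for B C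
    proof (rule ccontr)
      assume "\<Union> B \<inter> \<Union> C \<noteq> {}"
      then obtain x e g where xeg: "e \<in> B" "g \<in> C" "x \<in> e" "x \<in> g" by blast
      then have "e \<in> M" "g \<in> M" using BC Cs_subset by auto
      then show False using M_disjoint[OF _ _ xeg(3,4)] Cs_disjoint[OF BC(1,2)] xeg BC(3) by blast
    qed
    show "u B \<notin> \<Union> C" if "B \<in> Cs" "C \<in> Cs" for B C
      using that(1) uW UW CU[OF that(2)] by blast
    show "\<not> hits (u C) e" if "C \<in> Cs" "e \<in> C" for C e
      using that u(2) by (auto simp: NC_def)
    show "(W - u ` Cs) \<inter> \<Union> C = {}" if "C \<in> Cs" for C
      using UW CU[OF that] by blast
    show "(\<forall>e\<in>C. hits w e) \<or> (\<forall>e\<in>C. \<not> hits w e)" if "w \<in> W - u ` Cs" "C \<in> Cs" for w C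
    proof -
      have "N e = N g" if "e \<in> C" "g \<in> C" for e g
        using N_eq_NC[OF \<open>C \<in> Cs\<close>] that by simp
      then show ?thesis using \<open>w \<in> W - u ` Cs\<close> unfolding N_def by blast
    qed
    have "card (W - u ` Cs) = card W - card Cs"
      using u(1) uW finite_Cs by (simp add: card_Diff_subset card_image)
    \<comment> \<open>\<open>s_less\<close> gives \<open>s \<le> card W\<close>, and
      \<open>card W\<close> is the number of tokens and pool vertices together.\<close>
    then show "(\<Sum>C\<in>Cs. card C) \<le> card (W - u ` Cs) + card Cs"
      using sum_Cs card_W s_less by linarith
    show "finite (W - u ` Cs)" using finite_sets(3) by simp
  qed (use finite_Cs Cs_induced u(1) in blast)+
  moreover have "\<Union> (\<Union> Cs) \<union> u ` Cs \<union> (W - u ` Cs) \<subseteq> R"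
    unfolding Union_Cs using Union_M_subset uW W_subset by (auto simp: U_def)
  ultimately show ?thesis using packing_mono sum_Cs by simp
qed

text \<open>
  If the classes have no distinct representatives, then all the counting bounds above are
  attained: every class is a single edge, and every edge is missed by the same \<open>s - 1\<close> vertices.
\<close>

lemma packing_or_tight:
  "packing s R \<or> (\<exists>I \<subseteq> W. v \<in> I \<and> card I = s - 1 \<and> 2 \<le> s \<and> (\<forall>e\<in>M. N e = I) \<and>
     (\<forall>e\<in>M. \<forall>g\<in>M. e \<noteq> g \<longrightarrow> touch e g))"
proof (cases "\<exists>u. inj_on u Cs \<and> (\<forall>C\<in>Cs. u C \<in> NC C)")
  case True
  then show ?thesis using packing_if_representatives by blast
next
  case False
  define I where "I = (\<Union>C\<in>Cs. NC C)"
  have finI: "finite I" "I \<subseteq> W" using finite_sets(3) by (auto simp: I_def NC_def intro: finite_subset)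
  have finNC: "finite (NC C)" for C using finite_sets(3) by (auto simp: NC_def)
  have ge: "card Cs \<le> Suc (card (NC C))" if "C \<in> Cs" for C
    using card_NC_ge[OF that] card_Cs_le[OF that] by linarith
  \<comment> \<open>By \<open>ge\<close> each single set is large enough for
    \<open>ex_distinct_representatives_tight\<close>, so it is the bound on the union that
    fails.\<close>
  have lt: "card I < card Cs"
    using ex_distinct_representatives_tight[of Cs NC] False ge finNC finite_Cs unfolding I_def
    by (meson not_le)
  have NCI: "NC C = I" if "C \<in> Cs" for C
  proof (rule card_seteq[OF finI(1)])
    show "NC C \<subseteq> I" using that by (auto simp: I_def)
    show "card I \<le> card (NC C)" using lt ge[OF that] by linarith
  qed
  obtain C0 where C0: "C0 \<in> Cs" using lt by fastforce
  have cardI: "Suc (card I) = card Cs" using lt ge[OF C0] unfolding NCI[OF C0] by linarith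
  have vI: "v \<in> I"
  proof -
    have "\<not> hits v e" if "e \<in> C0" for e
      using that Cs_subset[OF C0] M_edge(2)[of e] U_props not_adj_v(1) unfolding hits_def by blast
    then have "v \<in> NC C0" using vW by (simp add: NC_def)
    then show ?thesis using NCI[OF C0] by simp
  qed
  then have "card I > 0" using finI card_gt_0_iff by blast
  then have two: "2 \<le> card Cs" using cardI by linarith
  have size: "s - card C = card Cs - 1" if "C \<in> Cs" for C
    using card_NC_ge[OF that] card_Cs_le[OF that] cardI unfolding NCI[OF that] by linarith
  \<comment> \<open>Seen from a class \<open>C\<close> other than \<open>D\<close>, the remaining
    classes have as many edges in total as there are such classes, so none has two.\<close>
  have one: "card D = 1" if D: "D \<in> Cs" for D
  proof (rule ccontr)
    assume "card D \<noteq> 1"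
    then have D1: "1 < card D" using card_Cs_pos[OF D] by linarith
    have "\<not> Cs \<subseteq> {D}" using two card_mono[of "{D}" Cs] by auto
    then obtain C where C: "C \<in> Cs" "C \<noteq> D" by blast
    have "card Cs - 1 = (\<Sum>E\<in>Cs - {C}. 1)" using C finite_Cs by simp
    also have "\<dots> < (\<Sum>E\<in>Cs - {C}. card E)"
      using C D D1 card_Cs_pos finite_Cs by (intro sum_strict_mono_ex1) auto
    finally show False using card_others[OF C(1)] size[OF C(1)] by simp
  qed
  have s: "s = card Cs" using sum_Cs one by simp
  have "touch e g" if "e \<in> M" "g \<in> M" "e \<noteq> g" for e g
  proof (rule ccontr)
    assume "\<not> touch e g"
    then have "{e, g} \<subseteq> cls e" "cls e \<in> Cs" using that by (auto simp: cls_def Cs_def)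
    then show False using one[of "cls e"] that(3) finite_Cs_elem[of "cls e"] card_mono[of "cls e" "{e, g}"] by auto
  qed
  moreover have "N e = I" if "e \<in> M" for e
  proof -
    have "cls e \<in> Cs" "e \<in> cls e" using that by (auto simp: Cs_def cls_def)
    then show ?thesis using N_eq_NC NCI by simp
  qed
  moreover have "card I = s - 1" "2 \<le> s" using s two cardI by linarith+
  ultimately show ?thesis using finI(2) vI by blast
qed

lemma packing_pairs:
  assumes "finite D" "D \<subseteq> M" "inj_on u D" "\<And>e. e \<in> D \<Longrightarrow> \<not> hits (u e) e" "u ` D \<subseteq> W"
  shows "packing (card D) (\<Union> D \<union> u ` D)"
  using assms
proof (induction D rule: finite_induct)
  case empty
  then show ?case by (simp add: packing_0)
next
  case (insert e D)
  then have eM: "e \<in> M" by simp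
  obtain x where "x \<in> e" using M_ne[OF eM] by blast
  then have e: "e = {x, f x}" and x: "x \<in> U" "f x \<in> U" "adj x (f x)"
    using M_edge[OF eM] fU by auto
  have uW: "u e \<in> W" using insert.prems by simp
  have "\<not> hits (u e) e" using insert.prems(3) by simp
  then have sg: "seagull x (f x) (u e)"
    using x uW adj_sym by (auto simp: seagull_def hits_def e U_def)
  have D: "D \<subseteq> M" using insert.prems by simp
  have "e \<inter> \<Union> D = {}"
  proof (rule ccontr)
    assume "e \<inter> \<Union> D \<noteq> {}"
    then obtain z g where "z \<in> e" "z \<in> g" "g \<in> D" by blast
    then show False using M_disjoint[OF eM, of g z] D insert.hyps by blast
  qed
  moreover have "e \<inter> u ` D = {}" "u e \<notin> \<Union> D" "u e \<notin> u ` D"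
  proof -
    show "e \<inter> u ` D = {}" using insert.prems(4) x(1,2) unfolding e U_def by blast
    have "\<Union> D \<subseteq> U" using D Union_M_subset by blast
    then show "u e \<notin> \<Union> D" using uW unfolding U_def by blast
    show "u e \<notin> u ` D" using insert.prems(2) insert.hyps by simp
  qed
  ultimately have disj: "{x, f x, u e} \<inter> (\<Union> D \<union> u ` D) = {}" unfolding e by blast
  have "packing (card D) (\<Union> D \<union> u ` D)"
    using insert.IH insert.prems by simp
  then have "packing (Suc (card D)) (\<Union> (insert e D) \<union> u ` insert e D)"
    by (rule packing_Suc[OF _ sg disj]) (auto simp: e)
  then show ?case using insert.hyps by simp
qed

section \<open>The tight case, where all edges are missed by the same vertices\<close>

context
  fixes I
  assumes I: "I \<subseteq> W" "v \<in> I" "card I = s - 1" "2 \<le> s" and N_eq_I: "\<And>e. e \<in> M \<Longrightarrow> N e = I"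
    and all_touch: "\<And>e g. e \<in> M \<Longrightarrow> g \<in> M \<Longrightarrow> e \<noteq> g \<Longrightarrow> touch e g"
begin

lemma pair_in_M: "x \<in> U \<Longrightarrow> {x, f x} \<in> M"
  by (auto simp: M_def)

text \<open>One hitting end from each of the \<open>s - 2\<close> other edges, together with
  \<open>x\<close> and \<open>f x\<close>, would make \<open>s\<close> vertices that hit
  \<open>e\<close>, but \<open>hit_count\<close> allows only \<open>card I = s - 1\<close>.\<close>

lemma not_both_hit:
  assumes e: "e \<in> M" and x: "x \<in> U" "x \<notin> e" "hits x e" "hits (f x) e"
  shows False
proof -
  let ?g = "{x, f x}"
  have g: "?g \<in> M" "?g \<noteq> e" using pair_in_M x(1,2) by auto
  have fx: "f x \<in> U" "f x \<noteq> x" "f x \<notin> e" using fU[OF x(1)] M_edge[OF e, of "f x"] x(2) by auto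
  obtain Y where Y: "Y \<subseteq> U \<inter> \<Union> (M - {e, ?g})" "card Y = card (M - {e, ?g})" "\<forall>y\<in>Y. hits y e"
    using transversal_count[OF e, of "M - {e, ?g}"] all_touch[OF e] by blast
  have "x \<notin> Y" "f x \<notin> Y" "Y \<inter> e = {}"
    using Y(1) M_disjoint[OF g(1)] M_disjoint[OF e] by blast+
  then have sub: "insert x (insert (f x) Y) \<subseteq> U - e" using Y(1) x fx by blast
  then have finY: "finite Y" using finite_sets(4) by (meson finite_Diff finite_insert finite_subset)
  have "card (insert x (insert (f x) Y)) \<le> card (N e)"
    by (rule hit_count[OF e sub]) (use Y(3) x in auto)
  moreover have "card (insert x (insert (f x) Y)) = card Y + 2"
    using finY \<open>x \<notin> Y\<close> \<open>f x \<notin> Y\<close> fx(2) by simp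
  moreover have "card (M - {e, ?g}) = card M - 2"
    using e g finite_sets(7) by (subst card_Diff_subset) auto
  ultimately show False using Y(2) card_M N_eq_I[OF e] I by simp
qed

lemma ex_hit: "w \<in> W - I \<Longrightarrow> e \<in> M \<Longrightarrow> \<exists>x\<in>e. adj w x"
  using N_eq_I[of e] by (auto simp: N_def hits_def)

text \<open>The other \<open>s - 2\<close> edges are paired with \<open>I - {v}\<close>. What is
  left yields two more seagulls: \<open>y\<close>, \<open>f y\<close> with \<open>f x\<close>, and
  \<open>w\<close>, \<open>x\<close> with \<open>v\<close>.\<close>

lemma packing_gain:
  assumes w: "w \<in> W - I" and x: "x \<in> U" and y: "y \<in> U" and ne: "{x, f x} \<noteq> {y, f y}"
    and wx: "adj w x" and miss: "\<not> hits (f x) {y, f y}"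
  shows "packing s R"
proof -
  let ?e = "{x, f x}" and ?g = "{y, f y}"
  let ?D = "M - {?e, ?g}"
  define X where "X = \<Union> ?D \<union> (I - {v})"
  have M: "?e \<in> M" "?g \<in> M" using pair_in_M x y by auto
  have card_D: "card ?D = s - 2"
    using M ne finite_sets(7) card_M by (subst card_Diff_subset) auto
  have finI: "finite I" using I(1) finite_sets(3) finite_subset by blast
  have "card (I - {v}) = s - 2" using I finI by simp
  then obtain u where u: "bij_betw u ?D (I - {v})"
    using finite_same_card_bij[of ?D "I - {v}"] card_D finite_sets(7) finI by auto
  have img: "u ` ?D = I - {v}" using u by (simp add: bij_betw_def)
  have "packing (card ?D) (\<Union> ?D \<union> u ` ?D)"
  proof (rule packing_pairs)
    show "\<not> hits (u e) e" if "e \<in> ?D" for e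
    proof -
      have "u e \<in> I" using img that by blast
      then show ?thesis using N_eq_I[of e] that by (auto simp: N_def)
    qed
    show "inj_on u ?D" using u by (simp add: bij_betw_def)
    show "u ` ?D \<subseteq> W" using img I(1) by blast
  qed (use finite_sets(7) in auto)
  then have p0: "packing (s - 2) X" using card_D img by (simp add: X_def)
  have eg: "{x, f x} \<inter> {y, f y} = {}" using M_disjoint[OF M] ne by blast
  have U': "x \<in> U" "f x \<in> U" "y \<in> U" "f y \<in> U" using x y fU by auto
  have UW: "U \<inter> W = {}" by (auto simp: U_def)
  have DU: "\<Union> ?D \<subseteq> U" using Union_M_subset by blast
  have "z \<notin> X" if "z \<in> ?e \<or> z \<in> ?g" for z
  proof -
    have "z \<notin> \<Union> ?D" using M_disjoint[OF M(1), of _ z] M_disjoint[OF M(2), of _ z] that by blast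
    moreover have "z \<notin> W" using that U' UW by blast
    ultimately show ?thesis using I(1) by (auto simp: X_def)
  qed
  then have X1: "x \<notin> X" "f x \<notin> X" "y \<notin> X" "f y \<notin> X" by simp_all
  have X2: "w \<notin> X" "v \<notin> X" using w DU UW vW by (auto simp: X_def)
  have XR: "X \<subseteq> R" using DU I(1) W_subset by (auto simp: X_def U_def)
  have "\<not> adj (f x) y" "\<not> adj (f x) (f y)" using miss by (auto simp: hits_def)
  then have sg1: "seagull y (f y) (f x)"
    using fU[OF y] eg by (auto simp: seagull_def adj_commute[of _ "f x"])
  have p1: "packing (Suc (s - 2)) (insert y (insert (f y) (insert (f x) X)))"
    by (rule packing_Suc[OF p0 sg1]) (use X1 in auto)
  have R: "w \<in> R" "x \<in> R" "f x \<in> R" "y \<in> R" "f y \<in> R"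
    using w W_subset U' U_props by auto
  have wv: "w \<notin> U" "w \<noteq> v" using w I(2) UW by auto
  have xv: "v \<notin> U" using vW UW by auto
  have sg2: "seagull w x v"
    using wx not_adj_v R wv xv U' by (auto simp: seagull_def)
  have "packing (Suc (Suc (s - 2))) R"
    by (rule packing_Suc[OF p1 sg2]) (use X1 X2 XR R wv xv U' eg fU(3)[OF x] vR in auto)
  moreover have "Suc (Suc (s - 2)) = s" using I(4) by simp
  ultimately show ?thesis by simp
qed

text \<open>By \<open>packing_gain\<close> in both directions, \<open>f x\<close> hits the pair of
  \<open>y\<close> and \<open>f y\<close> hits the pair of \<open>x\<close>. Then
  \<open>not_both_hit\<close> bars \<open>x\<close> and \<open>y\<close> from hitting the other
  pair, so the two partners hit each other.\<close>

lemma partners_adj: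
  assumes np: "\<not> packing s R" and w: "w \<in> W - I" and x: "x \<in> U" and y: "y \<in> U"
    and ne: "{x, f x} \<noteq> {y, f y}" and wx: "adj w x" and wy: "adj w y"
  shows "adj (f x) (f y)" "\<not> hits x {y, f y}"
proof -
  have disj: "x \<notin> {y, f y}" "y \<notin> {x, f x}" "f x \<noteq> y"
    using M_disjoint[OF pair_in_M[OF x] pair_in_M[OF y], of x]
      M_disjoint[OF pair_in_M[OF x] pair_in_M[OF y], of y]
      M_disjoint[OF pair_in_M[OF x] pair_in_M[OF y], of "f x"] ne by auto
  have "hits (f x) {y, f y}" using packing_gain[OF w x y ne wx] np by blast
  moreover have "hits (f y) {x, f x}" using packing_gain[OF w y x ne[symmetric] wy] np by blast
  ultimately have x': "\<not> hits x {y, f y}" and y': "\<not> hits y {x, f x}"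
    using not_both_hit[OF pair_in_M[OF y] x disj(1)] not_both_hit[OF pair_in_M[OF x] y disj(2)] by auto
  show "\<not> hits x {y, f y}" by fact
  show "adj (f x) (f y)"
    using \<open>hits (f x) {y, f y}\<close> y' by (auto simp: hits_def adj_commute[of y])
qed

lemma ex_hit_pair:
  assumes "w \<in> W - I" "e \<in> M"
  shows "\<exists>x\<in>U. e = {x, f x} \<and> adj w x"
proof -
  obtain x where x: "x \<in> e" "adj w x" using ex_hit[OF assms] by blast
  show ?thesis using M_edge[OF assms(2) x(1)] x(2) by blast
qed

lemma ex_not_in_I: "\<exists>w. w \<in> W - I"
proof -
  have "card I < card W" using I s_less card_W by linarith
  then have "\<not> W \<subseteq> I" using I(1) by auto
  then show ?thesis by blast
qed

text \<open>A vertex \<open>w\<close> of \<open>W\<close> outside of \<open>I\<close> hits every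
  edge of \<open>M\<close>. With three edges, the partners of the ends adjacent to \<open>w\<close>
  would form a triangle.\<close>

lemma tight_s_eq_2:
  assumes "\<not> packing s R"
  shows "s = 2"
proof (rule ccontr)
  assume "s \<noteq> 2"
  then have "3 \<le> card M" using I(4) card_M by simp
  then obtain T where T: "T \<subseteq> M" "card T = 3"
    by (meson obtain_subset_with_card_n)
  then obtain e g h where "T = {e, g, h}" "e \<noteq> g" "g \<noteq> h" "e \<noteq> h"
    by (auto simp: card_3_iff)
  then have M: "e \<in> M" "g \<in> M" "h \<in> M" using T by auto
  obtain w where w: "w \<in> W - I" using ex_not_in_I by blast
  obtain x where x: "x \<in> U" "e = {x, f x}" "adj w x" using ex_hit_pair[OF w M(1)] by blast
  obtain y where y: "y \<in> U" "g = {y, f y}" "adj w y" using ex_hit_pair[OF w M(2)] by blast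
  obtain z where z: "z \<in> U" "h = {z, f z}" "adj w z" using ex_hit_pair[OF w M(3)] by blast
  have "adj (f x) (f y)" using partners_adj(1)[OF assms w x(1) y(1) _ x(3) y(3)] x(2) y(2) \<open>e \<noteq> g\<close> by simp
  moreover have "adj (f y) (f z)" using partners_adj(1)[OF assms w y(1) z(1) _ y(3) z(3)] y(2) z(2) \<open>g \<noteq> h\<close> by simp
  moreover have "adj (f x) (f z)" using partners_adj(1)[OF assms w x(1) z(1) _ x(3) z(3)] x(2) z(2) \<open>e \<noteq> h\<close> by simp
  ultimately show False using triangle_free[of "f x" "f y" "f z"] by simp
qed

text \<open>A second vertex \<open>w'\<close> outside of \<open>I\<close> would be adjacent to the
  same ends \<open>x\<close> and \<open>y\<close>. Then \<open>w\<close>, \<open>x\<close>,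
  \<open>f y\<close> and \<open>w'\<close>, \<open>y\<close>, \<open>f x\<close> would be two
  disjoint seagulls, enough for \<open>s = 2\<close>.\<close>

lemma tight_W:
  assumes np: "\<not> packing s R" and w: "w \<in> W - I" and x: "x \<in> U" and y: "y \<in> U"
    and ne: "{x, f x} \<noteq> {y, f y}" and wx: "adj w x" and wy: "adj w y"
  shows "W - I = {w}"
proof (rule ccontr)
  assume "W - I \<noteq> {w}"
  then obtain w' where w': "w' \<in> W - I" "w' \<noteq> w" using w by blast
  have xy: "adj (f x) (f y)" "\<not> hits x {y, f y}" using partners_adj[OF np w x y ne wx wy] .
  have yx: "\<not> hits y {x, f x}" using partners_adj(2)[OF np w y x ne[symmetric] wy wx] .
  obtain x' where x': "x' \<in> U" "{x, f x} = {x', f x'}" "adj w' x'"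
    using ex_hit_pair[OF w'(1) pair_in_M[OF x]] by blast
  obtain y' where y': "y' \<in> U" "{y, f y} = {y', f y'}" "adj w' y'"
    using ex_hit_pair[OF w'(1) pair_in_M[OF y]] by blast
  have a': "adj (f x') (f y')"
    using partners_adj(1)[OF np w'(1) x'(1) y'(1) _ x'(3) y'(3)] ne x'(2) y'(2) by simp
  have "x' \<noteq> f x"
  proof
    assume "x' = f x"
    then have "adj x (f y')" "f y' \<in> {y, f y}" using a' y'(2) by auto
    then show False using xy(2) unfolding hits_def by blast
  qed
  then have x'x: "x' = x" using x'(2) by blast
  have "y' \<noteq> f y"
  proof
    assume "y' = f y"
    then have "adj y (f x')" "f x' \<in> {x, f x}" using a' x'(2) adj_sym by auto
    then show False using yx unfolding hits_def by blast
  qed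
  then have y'y: "y' = y" using y'(2) by blast
  have tri: "\<not> adj w (f y)" "\<not> adj w' (f x)"
    using triangle_free[OF wy fU(2)[OF y]] triangle_free[OF _ fU(2)[OF x], of w'] x'(3) x'x by auto
  have sub: "x \<in> U" "f x \<in> U" "y \<in> U" "f y \<in> U" "U \<inter> W = {}" using x y fU by (auto simp: U_def)
  have eg: "{x, f x} \<inter> {y, f y} = {}" using M_disjoint[OF pair_in_M[OF x] pair_in_M[OF y]] ne by blast
  have "seagull w x (f y)" "seagull w' y (f x)"
    using wx tri xy(2) yx y'(3) y'y w w' sub eg by (auto simp: seagull_def hits_def)
  moreover have "{w, x, f y} \<inter> {w', y, f x} = {}"
    using w w' sub eg fU(3)[OF x] fU(3)[OF y] by auto
  moreover have "{w, x, f y} \<union> ({w', y, f x} \<union> {}) \<subseteq> R"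
    using w w' sub W_subset U_props by auto
  ultimately have "packing (Suc (Suc 0)) R"
    by (intro packing_Suc[of 1 "{w', y, f x}" w x "f y", unfolded One_nat_def]
        packing_Suc[OF packing_0[of "{}"], of w' y "f x"]) auto
  then show False using np tight_s_eq_2[OF np] by (simp add: numeral_2_eq_2)
qed

text \<open>
  What remains is \<open>|V| = 9\<close> and \<open>|A| = 3\<close>, with a 5-cycle on \<open>U\<close> and one vertex of \<open>W\<close>. Two vertices
  of the cycle have a common neighbour \<open>a\<close> in \<open>A\<close>, and \<open>S\<close> arises from \<open>A\<close> by replacing \<open>a\<close> by them.
\<close>

lemma tight_case:
  assumes np: "\<not> packing s R"
  shows "\<exists>S X. S \<subseteq> V \<and> X \<subseteq> V - S \<and> indep S \<and> packing 1 X \<and> card S = k"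
proof -
  have s2: "s = 2" using tight_s_eq_2[OF np] .
  then have "card M = 2" using card_M by simp
  then obtain e g where M: "M = {e, g}" "e \<noteq> g" by (auto simp: card_2_iff)
  obtain w where w: "w \<in> W - I" using ex_not_in_I by blast
  obtain x where x: "x \<in> U" "e = {x, f x}" "adj w x" using ex_hit_pair[OF w, of e] M by blast
  obtain y where y: "y \<in> U" "g = {y, f y}" "adj w y" using ex_hit_pair[OF w, of g] M by blast
  have ne: "{x, f x} \<noteq> {y, f y}" using M(2) x y by simp
  have "W - I = {w}" using tight_W[OF np w x(1) y(1) ne x(3) y(3)] .
  then have "card W - card I = 1"
    using I(1) finite_sets(3) by (metis card_Diff_subset finite_subset is_singleton_altdef is_singletonI)
  then have A3: "card A = 3" and k4: "k = 4"
    using I(3) s2 card_W card_A unfolding s_def by linarith+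
  have Ueq: "U = {x, f x, y, f y}"
  proof -
    have "\<Union> M = U" using Union_M_subset pair_in_M by blast
    then show ?thesis using M x(2) y(2) by auto
  qed
  have eg: "{x, f x} \<inter> {y, f y} = {}"
    using M_disjoint[OF pair_in_M[OF x(1)] pair_in_M[OF y(1)]] ne by blast
  have wU: "w \<notin> U" and wR: "w \<in> R" using w W_subset by (auto simp: U_def)
  have UR: "U \<subseteq> R" by (auto simp: U_def)
  have ff': "adj (f x) (f y)" using partners_adj(1)[OF np w x(1) y(1) ne x(3) y(3)] .
  \<comment> \<open>The 5-cycle is \<open>w\<close>, \<open>x\<close>, \<open>f x\<close>,
    \<open>f y\<close>, \<open>y\<close>. Its vertices have two neighbours in \<open>R\<close> and
    degree at most three, hence at most one neighbour in \<open>A\<close>; \<open>edge_nbA\<close>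
    on a cycle edge then forces at least one.\<close>
  let ?Z = "insert w U"
  have nbR2: "2 \<le> card (nbR z)" if pq: "p \<in> R" "q \<in> R" "p \<noteq> q" "adj z p" "adj z q" for z p q
  proof -
    have "card {p, q} \<le> card (nbR z)"
      using pq by (intro card_mono finite_sets) (auto simp: nbR_def)
    then show ?thesis using pq(3) by simp
  qed
  have xR: "x \<in> R" "f x \<in> R" "y \<in> R" "f y \<in> R" using UR fU x(1) y(1) by auto
  have ax: "adj x (f x)" "adj (f x) x" "adj y (f y)" "adj (f y) y" "adj x w" "adj y w" "adj (f y) (f x)"
    using fU(2) x y ff' adj_sym by auto
  have ne': "f x \<noteq> w" "f y \<noteq> w" "x \<noteq> y" "x \<noteq> f y" "f x \<noteq> y"
    using wU fU(1) x(1) y(1) eg by auto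
  have "2 \<le> card (nbR w)" by (rule nbR2[OF xR(1,3) ne'(3) x(3) y(3)])
  moreover have "2 \<le> card (nbR x)" by (rule nbR2[OF xR(2) wR ne'(1) ax(1,5)])
  moreover have "2 \<le> card (nbR (f x))" by (rule nbR2[OF xR(1,4) ne'(4) ax(2) ff'])
  moreover have "2 \<le> card (nbR y)" by (rule nbR2[OF xR(4) wR ne'(2) ax(3,6)])
  moreover have "2 \<le> card (nbR (f y))" by (rule nbR2[OF xR(2,3) ne'(5) ax(7,4)])
  ultimately have two: "2 \<le> card (nbR z)" if "z \<in> ?Z" for z
    using that Ueq by auto
  have ZR: "?Z \<subseteq> R" using wR UR by blast
  have le1: "card (nbA z) \<le> 1" if "z \<in> ?Z" for z
    using two[OF that] card_nb[of z] ZR that A3 by fastforce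
  have ge1: "1 \<le> card (nbA z)" if "z \<in> ?Z" for z
  proof -
    have "\<exists>z'\<in>?Z. adj z z'"
      using that Ueq ax x(3) by auto
    then obtain z' where z': "z' \<in> ?Z" "adj z z'" by blast
    then have "card A \<le> Suc (card (nbA z) + card (nbA z'))"
      using edge_nbA[of z z'] ZR that by blast
    then show ?thesis using le1[OF z'(1)] A3 by linarith
  qed
  define h where "h z = (SOME a. a \<in> nbA z)" for z
  have h: "h z \<in> nbA z" if "z \<in> ?Z" for z
  proof -
    have "nbA z \<noteq> {}" using ge1[OF that] by auto
    then show ?thesis unfolding h_def by (simp add: some_in_eq)
  qed
  \<comment> \<open>Pigeonhole: the five vertices of the cycle have their neighbours among three
    vertices of \<open>A\<close>.\<close>
  have "card ?Z = 5"
    using card_U s2 wU finite_sets(4) by simp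
  moreover have "h ` ?Z \<subseteq> A" using h by (auto simp: nbA_def)
  ultimately have "\<not> inj_on h ?Z"
    using card_inj_on_le[of h ?Z A] finite_sets(1) A3 by auto
  then obtain p q where pq: "p \<in> ?Z" "q \<in> ?Z" "p \<noteq> q" "h p = h q"
    unfolding inj_on_def by blast
  define a where "a = h p"
  have a: "a \<in> A" "adj p a" "adj q a" using h[OF pq(1)] h[OF pq(2)] pq(4) by (auto simp: a_def nbA_def)
  have uniq: "b = a" if "z \<in> ?Z" "adj z a" "b \<in> A" "adj z b" for z b
  proof -
    have "{a, b} \<subseteq> nbA z" using that a(1) by (auto simp: nbA_def)
    then have "card {a, b} \<le> 1" using card_mono[OF finite_sets(5), of "{a, b}" z] le1[OF that(1)] by linarith
    then show ?thesis by (auto simp: card_insert_if split: if_splits)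
  qed
  define S where "S = insert p (insert q (A - {a}))"
  \<comment> \<open>One of the adjacent vertices \<open>x\<close> and \<open>f x\<close> is not
    adjacent to \<open>a\<close>. It completes the edge \<open>va\<close>, freed by removing
    \<open>a\<close> from \<open>A\<close>, to a seagull.\<close>
  obtain z where z: "z \<in> U" "\<not> adj z a"
    using triangle_free[OF fU(2)[OF x(1)], of a] fU(1)[OF x(1)] x(1) that by blast
  have pqR: "p \<in> R" "q \<in> R" using pq ZR by auto
  have AR: "A \<inter> R = {}" by (auto simp: R_def)
  have "\<not> adj p q" "\<not> adj q p"
    using triangle_free[of p q a] triangle_free[of q p a] a by blast+
  moreover have no: "\<not> adj p b" "\<not> adj q b" if "b \<in> A - {a}" for b
    using uniq[OF pq(1) a(2), of b] uniq[OF pq(2) a(3), of b] that by auto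
  moreover have "\<not> adj b p" "\<not> adj b q" if "b \<in> A - {a}" for b
    using no[OF that] adj_sym[of b p] adj_sym[of b q] by auto
  ultimately have "indep S"
    using A_indep adj_irrefl by (auto simp: indep_def S_def)
  moreover have "card S = k"
  proof -
    have "p \<notin> insert q (A - {a})" "q \<notin> A - {a}" using pq(3) pqR AR by auto
    then show ?thesis using finite_sets(1) a(1) A3 k4 by (simp add: S_def)
  qed
  moreover have "seagull v a z"
    using a(1) z not_adj_v(1)[of z] U_props[OF z(1)] adj_sym[of a z] by (auto simp: seagull_def A_def)
  then have "packing 1 {v, a, z}"
    using packing_Suc[OF packing_0[of "{}"], of v a z] by simp
  moreover have "S \<subseteq> V" using pqR by (auto simp: S_def R_def A_def)
  moreover have "{v, a, z} \<subseteq> V - S"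
  proof -
    have "v \<notin> ?Z" using w I(2) U_props by blast
    then have "v \<notin> S" using pq v_notin_A by (auto simp: S_def)
    moreover have "a \<notin> S" using a(1) pqR AR by (auto simp: S_def)
    moreover have "z \<notin> S" using z a U_props[OF z(1)] by (auto simp: S_def)
    ultimately show ?thesis using vV a(1) U_props[OF z(1)] by (auto simp: A_def)
  qed
  ultimately show ?thesis by blast
qed

end

theorem ex_indep_packing:
  "\<exists>S X p. S \<subseteq> V \<and> X \<subseteq> V - S \<and> indep S \<and> packing p X \<and> card S + p = k + 1"
proof (cases "packing s R")
  case True
  moreover have "A \<subseteq> V" "indep A" using A_indep by (auto simp: A_def indep_def)
  moreover have "card A + s = k + 1" using card_A by (simp add: s_def)
  ultimately show ?thesis unfolding R_def by blast
next
  case False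
  then obtain I where I: "I \<subseteq> W" "v \<in> I" "card I = s - 1" "2 \<le> s" "\<forall>e\<in>M. N e = I"
    "\<forall>e\<in>M. \<forall>g\<in>M. e \<noteq> g \<longrightarrow> touch e g"
    using packing_or_tight by blast
  have "\<exists>S X. S \<subseteq> V \<and> X \<subseteq> V - S \<and> indep S \<and> packing 1 X \<and> card S = k"
    by (rule tight_case[OF I(1-4) _ _ False]) (simp_all add: I(5,6))
  then obtain S X where "S \<subseteq> V" "X \<subseteq> V - S" "indep S" "packing 1 X" "card S = k"
    by blast
  then show ?thesis by (intro exI[of _ S] exI[of _ X] exI[of _ 1]) simp
qed

end

section \<open>Reduction to factor-critical graphs\<close>

context triangle_P3_K2_free
begin

text \<open>By \<open>linked_adj\<close> and transitivity it suffices to connect \<open>x\<close>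
  and \<open>y\<close> by a walk. A maximum matching that misses \<open>x\<close> matches its
  neighbour \<open>u\<close> to some \<open>w\<close>, which gives a path \<open>x\<close>,
  \<open>u\<close>, \<open>w\<close>; some vertex of it is adjacent to an end of any edge at
  \<open>y\<close>.\<close>

lemma all_linked:
  assumes fin: "finite V" and crit: "\<And>x. x \<in> V \<Longrightarrow> \<exists>g. max_matching V g \<and> x \<in> unmatched V g"
    and nbr: "\<And>x. x \<in> V \<Longrightarrow> \<exists>y\<in>V. adj x y"
    and x: "x \<in> V" and y: "y \<in> V"
  shows "linked V x y"
proof -
  have trans: "linked V p r" if "q \<in> V" "linked V p q" "linked V q r" for p q r
    by (rule linked_trans[OF fin crit[OF that(1)] that(2,3)])
  obtain u where u: "u \<in> V" "adj x u" using nbr[OF x] by blast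
  obtain g where g: "max_matching V g" "x \<in> unmatched V g" using crit[OF x] by blast
  have gm: "matching V g" using g(1) by (simp add: max_matching_def)
  have "x \<noteq> u" using u(2) adj_irrefl by auto
  then have "u \<notin> unmatched V g"
    using linked_adj[OF fin u(2)] g by (auto simp: linked_def)
  then have gu: "g u \<noteq> u" using u(1) by (simp add: unmatched_def)
  define w where "w = g u"
  have w: "adj u w" "w \<in> V" using matching_adj[OF gm gu] matching_in[OF gm u(1)] by (simp_all add: w_def)
  have "g x = x" using g(2) by (simp add: unmatched_def)
  then have "x \<noteq> w" using gu matching_invol[OF gm, of u] unfolding w_def by auto
  have xp: "linked V x p" if "p \<in> {x, u, w}" for p
    using that linked_adj[OF fin u(2)] trans[OF u(1) linked_adj[OF fin u(2)] linked_adj[OF fin w(1)]]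
    by (auto simp: linked_def[of V x x])
  obtain y' where y': "y' \<in> V" "adj y y'" using nbr[OF y] by blast
  obtain p q where pq: "p \<in> {x, u, w}" "q \<in> {y, y'}" "adj p q"
    using P3_K2_free[OF u(2) w(1) \<open>x \<noteq> w\<close> y'(2)] by blast
  have "p \<in> V" using pq(1) x u w by auto
  then have xq: "linked V x q" using trans xp[OF pq(1)] linked_adj[OF fin pq(3)] by blast
  show ?thesis
  proof (cases "q = y")
    case False
    then have "q = y'" using pq(2) by simp
    then show ?thesis using trans[OF y'(1)] xq linked_adj[OF fin adj_sym[OF y'(2)]] by blast
  qed (use xq in simp)
qed

lemma ex_indep_packing_critical:
  assumes fin: "finite V" and "V \<noteq> {}"
    and crit: "\<And>x. x \<in> V \<Longrightarrow> \<exists>g. max_matching V g \<and> x \<in> unmatched V g"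
    and nbr: "\<And>x. x \<in> V \<Longrightarrow> \<exists>y\<in>V. adj x y"
  shows "\<exists>f S X p. matching V f \<and> S \<subseteq> V \<and> X \<subseteq> V - S \<and> indep S \<and> packing p X \<and>
    card V + card (unmatched V f) \<le> 2 * (card S + p)"
proof -
  have missing: "\<exists>f. matching V f \<and> unmatched V f = {x}" if x: "x \<in> V" for x
  proof -
    obtain f where f: "max_matching V f" "x \<in> unmatched V f" using crit[OF x] by blast
    have "y = x" if y: "y \<in> unmatched V f" for y
    proof -
      have "y \<in> V" using y unmatched_subset by blast
      then have "linked V x y" using all_linked[OF fin crit nbr x] by blast
      then show ?thesis using f y by (auto simp: linked_def)
    qed
    then have "unmatched V f = {x}" using f(2) by blast
    then show ?thesis using f(1) unfolding max_matching_def by blast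
  qed
  let ?d = "\<lambda>x. card {y \<in> V. adj x y}"
  have "Max (?d ` V) \<in> ?d ` V" using fin \<open>V \<noteq> {}\<close> by (intro Max_in) auto
  then obtain v where v: "v \<in> V" "?d v = Max (?d ` V)" by auto
  have max: "?d x \<le> ?d v" if "x \<in> V" for x
    unfolding v(2) using fin that by (intro Max_ge) auto
  obtain a where a: "a \<in> V" "adj v a" using nbr[OF v(1)] by blast
  obtain f where f: "matching V f" "unmatched V f = {a}" using missing[OF a(1)] by blast
  have two: "2 * card ((\<lambda>x. {x, f x}) ` V) = card V + 1"
    using card_matching_classes[OF fin f(1)] f(2) by simp
  define k where "k = card ((\<lambda>x. {x, f x}) ` V) - 1"
  have k: "card V = 2 * k + 1" using two unfolding k_def by linarith
  \<comment> \<open>If the maximum degree exceeds \<open>k\<close>, the neighbourhood of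
    \<open>v\<close> is an independent set that suffices without seagulls.\<close>
  show ?thesis
  proof (cases "?d v \<le> k")
    case False
    have "indep {y \<in> V. adj v y}"
      using triangle_free adj_sym unfolding indep_def by blast
    then show ?thesis using f k False
      by (intro exI[of _ f] exI[of _ "{y \<in> V. adj v y}"] exI[of _ "{}"] exI[of _ 0])
        (auto simp: packing_0)
  next
    case True
    \<comment> \<open>A second neighbour of \<open>x\<close> is its partner in a matching that
      misses the neighbour \<open>y\<close>.\<close>
    have deg2: "2 \<le> ?d x" if x: "x \<in> V" for x
    proof -
      obtain y where y: "y \<in> V" "adj x y" using nbr[OF x] by blast
      obtain g where g: "matching V g" "unmatched V g = {y}" using missing[OF y(1)] by blast
      have "x \<noteq> y" using y(2) adj_irrefl by auto
      have gy: "g y = y" using g(2) by (auto simp: unmatched_def)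
      have gx: "g x \<noteq> x" using g(2) x \<open>x \<noteq> y\<close> by (auto simp: unmatched_def)
      have "g x \<noteq> y" using gy \<open>x \<noteq> y\<close> matching_eq_iff[OF g(1), of x y] by simp
      moreover have "{y, g x} \<subseteq> {y \<in> V. adj x y}"
        using y matching_adj[OF g(1) gx] matching_in[OF g(1) x] by simp
      then have "card {y, g x} \<le> ?d x" using fin by (intro card_mono) auto
      ultimately show ?thesis by simp
    qed
    interpret near_perfect adj V k v a f
      by unfold_locales (use fin k v(1) max deg2 a f True in auto)
    obtain S X p where "S \<subseteq> V" "X \<subseteq> V - S" "indep S" "packing p X" "card S + p = k + 1"
      using ex_indep_packing by blast
    then show ?thesis using f k by (intro exI[of _ f] exI[of _ S] exI[of _ X] exI[of _ p]) simp
  qed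
qed

text \<open>By \<open>card_matching_classes\<close>, the inequality bounds the number of classes of
  \<open>f\<close> by \<open>card S + p\<close>. The induction deletes a vertex that no maximum
  matching misses or that is isolated; otherwise the critical case applies.\<close>

theorem ex_matching_indep_packing:
  assumes "finite V"
  shows "\<exists>f S X p. matching V f \<and> S \<subseteq> V \<and> X \<subseteq> V - S \<and> indep S \<and> packing p X \<and>
    card V + card (unmatched V f) \<le> 2 * (card S + p)"
  using assms
proof (induction V rule: finite_psubset_induct)
  case (psubset V)
  note fin = psubset.hyps
  have del: "\<exists>f S X p. matching (V - {v}) f \<and> matching V f \<and> S \<subseteq> V - {v} \<and> X \<subseteq> V - {v} - S \<and>
      indep S \<and> packing p X \<and> card V + card (unmatched V f) \<le> 2 * (card S + p) + 2"
    if v: "v \<in> V" for v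
  proof -
    obtain f S X p where *: "matching (V - {v}) f" "S \<subseteq> V - {v}" "X \<subseteq> V - {v} - S" "indep S" "packing p X"
      "card (V - {v}) + card (unmatched (V - {v}) f) \<le> 2 * (card S + p)"
      using psubset.IH[of "V - {v}"] v by blast
    have "card (unmatched V f) = Suc (card (unmatched (V - {v}) f))"
      unfolding unmatched_Diff[OF *(1) v] using fin by (subst card_insert_disjoint) (auto simp: unmatched_def)
    moreover have "card V = Suc (card (V - {v}))" using card_Suc_Diff1[OF fin v] by simp
    moreover have "matching V f" by (rule matching_mono[OF *(1)]) blast
    ultimately show ?thesis using *
      by (intro exI[of _ f] exI[of _ S] exI[of _ X] exI[of _ p]) simp
  qed
  consider "V = {}" | v where "v \<in> V" "\<And>f. max_matching V f \<Longrightarrow> v \<notin> unmatched V f"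
    | v where "v \<in> V" "\<And>y. y \<in> V \<Longrightarrow> \<not> adj v y"
    | "V \<noteq> {}" "\<And>x. x \<in> V \<Longrightarrow> \<exists>g. max_matching V g \<and> x \<in> unmatched V g" "\<And>x. x \<in> V \<Longrightarrow> \<exists>y\<in>V. adj x y"
    by blast
  then show ?case
  proof cases
    case 1
    then show ?thesis
      by (intro exI[of _ "\<lambda>x. x"] exI[of _ "{}"] exI[of _ 0])
        (auto simp: matching_id packing_0 indep_def unmatched_def)
  next
    case (2 v)
    obtain f S X p where *: "matching (V - {v}) f" "matching V f" "S \<subseteq> V - {v}" "X \<subseteq> V - {v} - S"
      "indep S" "packing p X" "card V + card (unmatched V f) \<le> 2 * (card S + p) + 2"
      using del[OF 2(1)] by blast
    \<comment> \<open>Since \<open>f\<close> misses \<open>v\<close>, it is not maximum. Passing to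
      \<open>g\<close> saves a class, which pays for the \<open>+ 2\<close> in
      \<open>del\<close>.\<close>
    obtain g where g: "max_matching V g" using ex_max_matching by blast
    have gm: "matching V g" using g by (simp add: max_matching_def)
    have "v \<in> unmatched V f" using unmatched_Diff[OF *(1) 2(1)] by simp
    then have "\<not> max_matching V f" using 2(2) by blast
    then have "card (unmatched V g) < card (unmatched V f)"
      using g *(2) unfolding max_matching_def by (meson le_less_trans not_le)
    then have "card ((\<lambda>x. {x, g x}) ` V) < card ((\<lambda>x. {x, f x}) ` V)"
      using card_matching_classes[OF fin gm] card_matching_classes[OF fin *(2)] by linarith
    then have "card V + card (unmatched V g) \<le> 2 * (card S + p)"
      using card_matching_classes[OF fin gm] card_matching_classes[OF fin *(2)] *(7) by linarith
    then show ?thesis using gm * by blast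
  next
    case (3 v)
    obtain f S X p where *: "matching V f" "S \<subseteq> V - {v}" "X \<subseteq> V - {v} - S"
      "indep S" "packing p X" "card V + card (unmatched V f) \<le> 2 * (card S + p) + 2"
      using del[OF 3(1)] by blast
    have "indep (insert v S)"
      using *(2,4) 3 adj_sym unfolding indep_def by blast
    moreover have "card (insert v S) = Suc (card S)"
      using *(2) fin finite_subset by (subst card_insert_disjoint) auto
    ultimately show ?thesis using * 3(1)
      by (intro exI[of _ f] exI[of _ "insert v S"] exI[of _ X] exI[of _ p]) auto
  next
    case 4
    then show ?thesis by (intro ex_indep_packing_critical fin)
  qed
qed

end

section \<open>Graphs and odd minors\<close>

text \<open>The inverse of \<open>h\<close> is an isomorphism from the subgraph induced on the image
  of \<open>h\<close> to \<open>F\<close>.\<close>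

lemma not_free_of_if_embedding:
  assumes G: "pair_graph G" and F: "pair_graph F" "F \<in> \<F>"
    and h: "inj_on h (pverts F)" "h ` pverts F \<subseteq> pverts G"
    and arcs: "\<And>i j. i \<in> pverts F \<Longrightarrow> j \<in> pverts F \<Longrightarrow> (h i, h j) \<in> parcs G \<longleftrightarrow> (i, j) \<in> parcs F"
  shows "\<not> free_of \<F> G"
proof -
  interpret G: pair_graph G by fact
  interpret F: pair_graph F by fact
  define S where "S = h ` pverts F"
  define g where "g = the_inv_into (pverts F) h"
  have gh: "g (h i) = i" if "i \<in> pverts F" for i
    using that h(1) by (simp add: g_def the_inv_into_f_f)
  define H where "H = \<lparr> pverts = S, parcs = parcs G \<inter> S \<times> S \<rparr>"
  have wfH: "wf_digraph (with_proj H)"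
    by unfold_locales (auto simp: H_def)
  have ind: "induced_subgraph (with_proj H) (with_proj G)"
    using h(2) wfH G.wf_digraph_axioms
    by (auto simp: induced_subgraph_def subgraph_def H_def S_def)
  define iso where "iso = \<lparr> iso_verts = g, iso_arcs = map_prod g g, iso_head = snd, iso_tail = fst \<rparr>"
  have "inj_on g S"
  proof (rule inj_onI)
    fix x y assume "x \<in> S" "y \<in> S" "g x = g y"
    then show "x = y" unfolding S_def using gh by (elim imageE) simp
  qed
  then have "inj_on (map_prod g g) (parcs G \<inter> S \<times> S)"
    by (intro inj_onI) (auto dest: inj_onD)
  then have "pre_digraph.digraph_isomorphism (with_proj H) iso"
    using wfH \<open>inj_on g S\<close> by (auto simp: pre_digraph.digraph_isomorphism_def iso_def H_def)
  moreover have "with_proj F = app_iso iso (with_proj H)"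
  proof -
    have "g ` S = pverts F" using gh by (force simp: S_def)
    moreover have "map_prod g g ` (parcs G \<inter> S \<times> S) = parcs F"
    proof (intro equalityI subsetI)
      fix e assume "e \<in> map_prod g g ` (parcs G \<inter> S \<times> S)"
      then show "e \<in> parcs F" using gh arcs by (auto simp: S_def)
    next
      fix e assume e: "e \<in> parcs F"
      then obtain i j where ij: "e = (i, j)" "i \<in> pverts F" "j \<in> pverts F"
        using F.in_arcsD1 F.in_arcsD2 by (cases e) auto
      then have "(h i, h j) \<in> parcs G \<inter> S \<times> S" "e = map_prod g g (h i, h j)"
        using e arcs gh by (auto simp: S_def)
      then show "e \<in> map_prod g g ` (parcs G \<inter> S \<times> S)" by blast
    qed
    ultimately show ?thesis by (simp add: app_iso_def iso_def H_def with_proj_def)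
  qed
  ultimately have "digraph_iso (with_proj H) (with_proj F)"
    by (auto simp: digraph_iso_def)
  then show ?thesis using ind F(2) by (auto simp: free_of_def)
qed

section \<open>Trees with one and with three vertices\<close>

definition single_vertex :: "'a \<Rightarrow> 'a pair_pre_digraph" where
  "single_vertex v = \<lparr> pverts = {v}, parcs = {} \<rparr>"

definition path3 :: "'a \<Rightarrow> 'a \<Rightarrow> 'a \<Rightarrow> 'a pair_pre_digraph" where
  "path3 a b c = \<lparr> pverts = {a, b, c}, parcs = {(a, b), (b, a), (b, c), (c, b)} \<rparr>"

lemma mk_symmetric_pair_graph:
  assumes "pair_graph T"
  shows "mk_symmetric (with_proj T) = T"
proof -
  interpret pair_graph T by fact
  have "(v, u) \<in> parcs T" if "(u, v) \<in> parcs T" for u v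
    using that pair_sym_arcs by (auto simp: symmetric_def sym_def)
  then show ?thesis by (auto simp: mk_symmetric_def intro!: pair_pre_digraph.equality)
qed

lemma undirected_tree_single_vertex: "undirected_tree (single_vertex v)"
proof -
  have T: "pair_graph (single_vertex v)"
    by unfold_locales (auto simp: single_vertex_def symmetric_def sym_def)
  interpret pair_graph "single_vertex v" by fact
  have verts: "pverts (single_vertex v) = {v}" by (simp add: single_vertex_def)
  then have "v \<rightarrow>\<^sup>*\<^bsub>with_proj (single_vertex v)\<^esub> v"
    by (intro reachable_refl) simp
  then have "connected (with_proj (single_vertex v))"
    unfolding connected_def mk_symmetric_pair_graph[OF T] strongly_connected_def
    by (simp add: verts)
  moreover have "\<not> pre_digraph.cycle (with_proj (single_vertex v)) p" for p
    by (auto simp: pre_digraph.cycle_def pre_digraph.awalk_def single_vertex_def)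
  ultimately show ?thesis using T by (simp add: undirected_tree_def)
qed

lemma undirected_tree_path3:
  assumes "distinct [a, b, c]"
  shows "undirected_tree (path3 a b c)"
proof -
  have T: "pair_graph (path3 a b c)"
    by unfold_locales (use assms in \<open>auto simp: path3_def symmetric_def sym_def\<close>)
  interpret pair_graph "path3 a b c" by fact
  let ?T = "with_proj (path3 a b c)"
  have arc: "a \<rightarrow>\<^sup>*\<^bsub>?T\<^esub> b" "b \<rightarrow>\<^sup>*\<^bsub>?T\<^esub> a" "b \<rightarrow>\<^sup>*\<^bsub>?T\<^esub> c" "c \<rightarrow>\<^sup>*\<^bsub>?T\<^esub> b"
    by (rule reachable_adjI; simp add: path3_def)+
  have "a \<rightarrow>\<^sup>*\<^bsub>?T\<^esub> c" "c \<rightarrow>\<^sup>*\<^bsub>?T\<^esub> a"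
    using arc reachable_trans by blast+
  moreover have verts: "pverts (path3 a b c) = {a, b, c}" by (simp add: path3_def)
  moreover have "a \<rightarrow>\<^sup>*\<^bsub>?T\<^esub> a" "b \<rightarrow>\<^sup>*\<^bsub>?T\<^esub> b" "c \<rightarrow>\<^sup>*\<^bsub>?T\<^esub> c"
    by (intro reachable_refl; simp add: verts)+
  ultimately have "connected ?T"
    unfolding connected_def mk_symmetric_pair_graph[OF T] strongly_connected_def
    using arc by simp
  moreover have "\<not> (pre_digraph.cycle ?T p \<and> 3 \<le> length p)" for p
  proof
    assume p: "pre_digraph.cycle ?T p \<and> 3 \<le> length p"
    then obtain u where u: "set p \<subseteq> parcs (path3 a b c)" "pcas u p u" "distinct (tl (pawalk_verts u p))"
      by (auto simp: pre_digraph.cycle_def pre_digraph.awalk_def cas_with_proj_eq awalk_verts_with_proj_eq)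
    \<comment> \<open>The second to fourth vertices of the cycle are distinct, so the third one is
      \<open>b\<close>, and so is the first. If the walk stops after three arcs, it is not closed;
      if it goes on, it comes back to \<open>b\<close> too early.\<close>
    obtain e1 e2 e3 r where "p = e1 # e2 # e3 # r"
      using p by (metis Suc_le_length_iff numeral_3_eq_3)
    moreover have "x \<in> set (pawalk_verts x l)" if "pcas x l y" for x y and l :: "('a \<times> 'a) list"
      using that by (cases l) auto
    ultimately show False using u assms
      by (cases r; cases e1; cases e2; cases e3) (auto simp: path3_def)
  qed
  ultimately show ?thesis using T by (auto simp: undirected_tree_def)
qed

text \<open>The complement of \<open>G\<close>; elements of the type that are not vertices of
  \<open>G\<close> are isolated in it.\<close>

definition nonadj :: "'a pair_pre_digraph \<Rightarrow> 'a \<Rightarrow> 'a \<Rightarrow> bool" where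
  "nonadj G x y \<longleftrightarrow> x \<in> pverts G \<and> y \<in> pverts G \<and> x \<noteq> y \<and> (x, y) \<notin> parcs G"

lemma pair_graph_sym: "pair_graph G \<Longrightarrow> (x, y) \<in> parcs G \<longleftrightarrow> (y, x) \<in> parcs G"
proof -
  assume "pair_graph G"
  then interpret pair_graph G .
  show ?thesis using pair_sym_arcs by (auto simp: symmetric_def sym_def)
qed

lemma pair_graph_irrefl: "pair_graph G \<Longrightarrow> (x, x) \<notin> parcs G"
proof -
  assume "pair_graph G"
  then interpret pair_graph G .
  show ?thesis using pair_no_loops[of "(x, x)"] by auto
qed

text \<open>A triangle of the complement is an induced \<open>3K1\<close> of \<open>G\<close>, and
  the paraglider is the complement of \<open>P3 + K2\<close>.\<close>

lemma triangle_P3_K2_free_nonadj: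
  assumes G: "pair_graph G" and free: "free_of {edgeless_graph_3, paraglider} G"
  shows "triangle_P3_K2_free (nonadj G)"
proof
  show "nonadj G y x" if "nonadj G x y" for x y
    using that pair_graph_sym[OF G] by (auto simp: nonadj_def)
  show "\<not> nonadj G x x" for x by (simp add: nonadj_def)
  show tri: "\<not> nonadj G x z" if xyz: "nonadj G x y" "nonadj G y z" for x y z
  proof
    assume xz: "nonadj G x z"
    define h where "h = (\<lambda>i::nat. if i = 0 then x else if i = 1 then y else z)"
    have "\<not> free_of {edgeless_graph_3, paraglider} G"
    proof (rule not_free_of_if_embedding[OF G pair_graph_edgeless_graph_3])
      show "inj_on h (pverts edgeless_graph_3)"
        using xyz xz by (auto simp: inj_on_def h_def edgeless_graph_3_def nonadj_def)
      show "h ` pverts edgeless_graph_3 \<subseteq> pverts G"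
        using xyz xz by (auto simp: h_def edgeless_graph_3_def nonadj_def)
      show "(h i, h j) \<in> parcs G \<longleftrightarrow> (i, j) \<in> parcs edgeless_graph_3"
        if "i \<in> pverts edgeless_graph_3" "j \<in> pverts edgeless_graph_3" for i j
        using that xyz xz pair_graph_irrefl[OF G] pair_graph_sym[OF G]
        by (auto simp: h_def edgeless_graph_3_def nonadj_def)
    qed simp
    then show False using free by simp
  qed
  show "\<exists>p\<in>{a, b, c}. \<exists>q\<in>{x, y}. nonadj G p q"
    if abc: "nonadj G a b" "nonadj G b c" "a \<noteq> c" and xy: "nonadj G x y" for a b c x y
  proof (rule ccontr)
    assume no: "\<not> (\<exists>p\<in>{a, b, c}. \<exists>q\<in>{x, y}. nonadj G p q)"
    have sym: "nonadj G p q \<longleftrightarrow> nonadj G q p" for p q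
      using pair_graph_sym[OF G] by (auto simp: nonadj_def)
    have V: "a \<in> pverts G" "b \<in> pverts G" "c \<in> pverts G" "x \<in> pverts G" "y \<in> pverts G"
      using abc xy by (auto simp: nonadj_def)
    have ne: "p \<noteq> q" if "p \<in> {a, b, c}" "q \<in> {x, y}" for p q
    proof
      assume "p = q"
      then have "nonadj G p x \<or> nonadj G p y" using that(2) xy sym[of x y] by auto
      then show False using no that(1) by auto
    qed
    have adj: "(p, q) \<in> parcs G" if "p \<in> {a, b, c}" "q \<in> {x, y}" for p q
      using no that ne[OF that] V by (auto simp: nonadj_def)
    have adj': "(a, x) \<in> parcs G" "(a, y) \<in> parcs G" "(b, x) \<in> parcs G" "(b, y) \<in> parcs G"
      "(c, x) \<in> parcs G" "(c, y) \<in> parcs G" "(a, c) \<in> parcs G"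
      using adj tri[OF abc(1,2)] V abc(3) by (auto simp: nonadj_def)
    have nadj: "(a, b) \<notin> parcs G" "(b, c) \<notin> parcs G" "(x, y) \<notin> parcs G"
      using abc xy by (auto simp: nonadj_def)
    have dist: "a \<noteq> b" "b \<noteq> c" "a \<noteq> c" "x \<noteq> y" "a \<noteq> x" "a \<noteq> y" "b \<noteq> x" "b \<noteq> y" "c \<noteq> x" "c \<noteq> y"
      using abc xy ne[of a x] ne[of a y] ne[of b x] ne[of b y] ne[of c x] ne[of c y]
      by (auto simp: nonadj_def)
    \<comment> \<open>The 4-cycle is \<open>x\<close>, \<open>a\<close>, \<open>y\<close>,
      \<open>b\<close>, and \<open>c\<close> is the added vertex, adjacent to all of them but
      \<open>b\<close>.\<close>
    define h where "h = (\<lambda>i::nat. if i = 0 then x else if i = 1 then a else if i = 2 then y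
      else if i = 3 then b else c)"
    have h: "h 0 = x" "h 1 = a" "h 2 = y" "h 3 = b" "h 4 = c" by (simp_all add: h_def)
    have verts: "pverts paraglider = {0, 1, 2, 3, 4}" by (simp add: paraglider_def)
    have "\<not> free_of {edgeless_graph_3, paraglider} G"
    proof (rule not_free_of_if_embedding[OF G pair_graph_paraglider])
      show "inj_on h (pverts paraglider)"
        unfolding verts using dist h by (auto simp: inj_on_def)
      show "h ` pverts paraglider \<subseteq> pverts G"
        unfolding verts using V h by auto
      show "(h i, h j) \<in> parcs G \<longleftrightarrow> (i, j) \<in> parcs paraglider"
        if "i \<in> pverts paraglider" "j \<in> pverts paraglider" for i j
      proof -
        have sym': "(q, p) \<in> parcs G \<longleftrightarrow> (p, q) \<in> parcs G" for p q
          using pair_graph_sym[OF G] .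
        have all: "(x, a) \<in> parcs G" "(y, a) \<in> parcs G" "(x, b) \<in> parcs G" "(y, b) \<in> parcs G"
          "(x, c) \<in> parcs G" "(y, c) \<in> parcs G" "(c, a) \<in> parcs G"
          "(b, a) \<notin> parcs G" "(c, b) \<notin> parcs G" "(y, x) \<notin> parcs G"
          using adj' nadj sym' by blast+
        show ?thesis using that unfolding verts
          by (elim insertE emptyE; simp only: h)
            (simp_all add: all adj' nadj pair_graph_irrefl[OF G] paraglider_def Let_def)
      qed
    qed simp
    then show False using free by simp
  qed
qed

text \<open>The invariant for adding seagulls one by one: the trees stay inside \<open>Y\<close>,
  joining edges have both ends coloured \<open>True\<close>, and each tree has a vertex of this
  colour even if there is no other tree.\<close>

definition odd_minor_in :: "'a pair_pre_digraph \<Rightarrow> 'a set \<Rightarrow> nat \<Rightarrow> bool" where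
  "odd_minor_in G Y t \<longleftrightarrow>
     (\<exists>(T :: nat \<Rightarrow> 'a pair_pre_digraph) c.
        (\<forall>i<t. undirected_tree (T i) \<and> subgraph (with_proj (T i)) (with_proj G) \<and> pverts (T i) \<subseteq> Y \<and>
           (\<exists>u\<in>pverts (T i). c u)) \<and>
        (\<forall>i<t. \<forall>j<t. i \<noteq> j \<longrightarrow> pverts (T i) \<inter> pverts (T j) = {}) \<and>
        (\<forall>i<t. \<forall>(u, v)\<in>parcs (T i). c u \<noteq> c v) \<and>
        (\<forall>i<t. \<forall>j<t. i \<noteq> j \<longrightarrow>
           (\<exists>u\<in>pverts (T i). \<exists>v\<in>pverts (T j). (u, v) \<in> parcs G \<and> c u \<and> c v)))"

lemma has_odd_clique_minor_if_odd_minor_in: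
  assumes "odd_minor_in G Y t"
  shows "has_odd_clique_minor G t"
proof -
  obtain T c where T: "\<forall>i<t. undirected_tree (T i) \<and> subgraph (with_proj (T i)) (with_proj G) \<and>
        pverts (T i) \<subseteq> Y \<and> (\<exists>u\<in>pverts (T i). c u)"
    and rest: "\<forall>i<t. \<forall>j<t. i \<noteq> j \<longrightarrow> pverts (T i) \<inter> pverts (T j) = {}"
      "\<forall>i<t. \<forall>(u, v)\<in>parcs (T i). c u \<noteq> c v"
    and join: "\<forall>i<t. \<forall>j<t. i \<noteq> j \<longrightarrow>
      (\<exists>u\<in>pverts (T i). \<exists>v\<in>pverts (T j). (u, v) \<in> parcs G \<and> c u \<and> c v)"
    using assms unfolding odd_minor_in_def by (elim exE conjE) (rule that)
  have "\<exists>u\<in>pverts (T i). \<exists>v\<in>pverts (T j). (u, v) \<in> parcs G \<and> c u = c v"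
    if "i < t" "j < t" "i \<noteq> j" for i j
    using join[rule_format, OF that] by auto
  then show ?thesis
    unfolding has_odd_clique_minor_def using T rest
    by (intro exI[of _ T] exI[of _ c]) simp
qed

lemma odd_minor_in_mono:
  assumes "odd_minor_in G Y t" "Y \<subseteq> Z"
  shows "odd_minor_in G Z t"
proof -
  have "pverts T \<subseteq> Z" if "pverts T \<subseteq> Y" for T :: "'a pair_pre_digraph"
    using that assms(2) by simp
  then show ?thesis
    using assms(1) unfolding odd_minor_in_def by (elim exE conjE, intro exI conjI) simp_all
qed

lemma subgraph_pair_graph:
  assumes "pair_graph G" "pair_graph T" "pverts T \<subseteq> pverts G" "parcs T \<subseteq> parcs G"
  shows "subgraph (with_proj T) (with_proj G)"
proof -
  interpret G: pair_graph G by fact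
  interpret T: pair_graph T by fact
  show ?thesis
    using assms(3,4) G.wf_digraph_axioms T.wf_digraph_axioms by (auto simp: subgraph_def)
qed

lemma odd_minor_in_clique:
  assumes G: "pair_graph G" and S: "finite S" "S \<subseteq> pverts G"
    and clique: "\<And>x y. x \<in> S \<Longrightarrow> y \<in> S \<Longrightarrow> x \<noteq> y \<Longrightarrow> (x, y) \<in> parcs G"
  shows "odd_minor_in G S (card S)"
proof -
  obtain h where "bij_betw h {0..<card S} S"
    using ex_bij_betw_nat_finite[OF S(1)] by blast
  then have h: "h i \<in> S" "i \<noteq> j \<Longrightarrow> h i \<noteq> h j" if "i < card S" "j < card S" for i j
    using that by (auto simp: bij_betw_def inj_on_def)
  have tree: "undirected_tree (single_vertex x) \<and> subgraph (with_proj (single_vertex x)) (with_proj G)"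
    if "x \<in> S" for x
    using that S(2) undirected_tree_single_vertex[of x] subgraph_pair_graph[OF G, of "single_vertex x"]
    by (auto simp: undirected_tree_def) (auto simp: single_vertex_def)
  have verts: "pverts (single_vertex x) = {x}" "parcs (single_vertex x) = {}" for x
    by (simp_all add: single_vertex_def)
  show ?thesis
    unfolding odd_minor_in_def
    by (intro exI[of _ "\<lambda>i. single_vertex (h i)"] exI[of _ "\<lambda>_. True"])
      (use h clique tree in \<open>auto simp: verts\<close>)
qed

text \<open>The ends of the new tree are coloured \<open>True\<close> and its middle
  \<open>False\<close>. Every old tree has a vertex of colour \<open>True\<close> in
  \<open>Y\<close>, and \<open>dom\<close> joins it to one of the ends.\<close>

lemma odd_minor_in_path3:
  assumes G: "pair_graph G" and minor: "odd_minor_in G Y t"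
    and abc: "distinct [a, b, c]" "{a, b, c} \<inter> Y = {}" "(a, b) \<in> parcs G" "(b, c) \<in> parcs G"
    and dom: "\<And>y. y \<in> Y \<Longrightarrow> y \<in> pverts G \<Longrightarrow> (y, a) \<in> parcs G \<or> (y, c) \<in> parcs G"
  shows "odd_minor_in G (Y \<union> {a, b, c}) (Suc t)"
proof -
  interpret G: pair_graph G by fact
  obtain T k where T0: "\<forall>i<t. undirected_tree (T i) \<and> subgraph (with_proj (T i)) (with_proj G) \<and>
        pverts (T i) \<subseteq> Y \<and> (\<exists>u\<in>pverts (T i). k u)"
    and disj0: "\<forall>i<t. \<forall>j<t. i \<noteq> j \<longrightarrow> pverts (T i) \<inter> pverts (T j) = {}"
    and bi0: "\<forall>i<t. \<forall>(u, v)\<in>parcs (T i). k u \<noteq> k v"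
    and join0: "\<forall>i<t. \<forall>j<t. i \<noteq> j \<longrightarrow>
      (\<exists>u\<in>pverts (T i). \<exists>v\<in>pverts (T j). (u, v) \<in> parcs G \<and> k u \<and> k v)"
    using minor unfolding odd_minor_in_def by (elim exE conjE) (rule that)
  note T = T0[rule_format] and disj = disj0[rule_format] and join = join0[rule_format]
  have bi: "k u \<noteq> k v" if "i < t" "(u, v) \<in> parcs (T i)" for i u v
    using bi0 that by blast
  let ?P = "path3 a b c"
  define T' where "T' = T(t := ?P)"
  define k' where "k' x = (if x \<in> {a, b, c} then x \<noteq> b else k x)" for x
  have T'_simps: "T' t = ?P" "\<And>i. i < t \<Longrightarrow> T' i = T i" by (auto simp: T'_def)
  have P: "pverts ?P = {a, b, c}" "parcs ?P = {(a, b), (b, a), (b, c), (c, b)}"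
    by (simp_all add: path3_def)
  have tree: "undirected_tree ?P" by (rule undirected_tree_path3[OF abc(1)])
  have abcV: "a \<in> pverts G" "b \<in> pverts G" "c \<in> pverts G"
    using abc(3,4) G.in_arcsD1 G.in_arcsD2 by auto
  have sub: "subgraph (with_proj ?P) (with_proj G)"
    using tree abc(3,4) abcV pair_graph_sym[OF G]
    by (intro subgraph_pair_graph[OF G]) (auto simp: undirected_tree_def P)
  have k'Y: "k' y = k y" if "y \<in> Y" for y using that abc(2) by (auto simp: k'_def)
  have k'T: "k' y = k y" if "i < t" "y \<in> pverts (T i)" for i y
    using k'Y T[OF that(1)] that(2) by blast
  have arcsT: "u \<in> pverts (T i) \<and> v \<in> pverts (T i)" if "i < t" "(u, v) \<in> parcs (T i)" for i u v
  proof -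
    interpret Ti: pair_graph "T i" using T[OF that(1)] by (simp add: undirected_tree_def)
    show ?thesis using Ti.in_arcsD1 Ti.in_arcsD2 that(2) by blast
  qed
  have link: "\<exists>u\<in>pverts (T i). \<exists>v\<in>{a, b, c}. (u, v) \<in> parcs G \<and> k' u \<and> k' v" if i: "i < t" for i
  proof -
    obtain u where u: "u \<in> pverts (T i)" "k u" using T[OF i] by blast
    have "pverts (T i) \<subseteq> pverts G" using T[OF i] by (auto simp: subgraph_def)
    then have "(u, a) \<in> parcs G \<or> (u, c) \<in> parcs G" using dom u(1) T[OF i] by blast
    moreover have "k' u" "k' a" "k' c" using k'T[OF i u(1)] u(2) abc(1) by (auto simp: k'_def)
    ultimately show ?thesis using u(1) by blast
  qed
  show ?thesis
    unfolding odd_minor_in_def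
  proof (intro exI[of _ T'] exI[of _ k'] conjI allI impI)
    fix i assume i: "i < Suc t"
    have tree_i: "undirected_tree (T' i) \<and> subgraph (with_proj (T' i)) (with_proj G) \<and>
        pverts (T' i) \<subseteq> Y \<union> {a, b, c} \<and> (\<exists>u\<in>pverts (T' i). k' u)"
    proof (cases "i = t")
      case True
      have "k' a" using abc(1) by (simp add: k'_def)
      then show ?thesis using True tree sub by (simp add: T'_simps P)
    next
      case False
      then have i': "i < t" using i by simp
      obtain u where "u \<in> pverts (T i)" "k u" using T[OF i'] by blast
      then have "\<exists>u\<in>pverts (T i). k' u" using k'T[OF i'] by blast
      moreover have "pverts (T i) \<subseteq> Y \<union> {a, b, c}" using T[OF i'] by blast
      ultimately show ?thesis using T[OF i'] unfolding T'_simps(2)[OF i'] by blast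
    qed
    then show "undirected_tree (T' i)" "subgraph (with_proj (T' i)) (with_proj G)"
      "pverts (T' i) \<subseteq> Y \<union> {a, b, c}" "\<exists>u\<in>pverts (T' i). k' u"
      by simp_all
    show "\<forall>(u, v)\<in>parcs (T' i). k' u \<noteq> k' v"
    proof (cases "i = t")
      case True
      then show ?thesis using T'_simps P abc(1) by (auto simp: k'_def)
    next
      case False
      then have i': "i < t" using i by simp
      have "k' u \<noteq> k' v" if "(u, v) \<in> parcs (T i)" for u v
        using bi[OF i' that] arcsT[OF i' that] k'T[OF i'] by simp
      then show ?thesis unfolding T'_simps(2)[OF i'] by blast
    qed
    fix j assume j: "j < Suc t" "i \<noteq> j"
    have PT: "{a, b, c} \<inter> pverts (T l) = {}" if "l < t" for l
      using T[OF that] abc(2) by blast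
    consider "i = t" "j < t" | "j = t" "i < t" | "i < t" "j < t" using i j by linarith
    then show "pverts (T' i) \<inter> pverts (T' j) = {}"
    proof cases
      case 1
      then show ?thesis using PT[OF 1(2)] by (simp add: T'_simps P)
    next
      case 2
      then show ?thesis using PT[OF 2(2)] by (simp add: T'_simps P Int_commute)
    next
      case 3
      then show ?thesis using disj j(2) by (simp add: T'_simps)
    qed
    consider "i = t" "j < t" | "j = t" "i < t" | "i < t" "j < t" using i j by linarith
    then show "\<exists>u\<in>pverts (T' i). \<exists>v\<in>pverts (T' j). (u, v) \<in> parcs G \<and> k' u \<and> k' v"
    proof cases
      case 1
      obtain u v where uv: "u \<in> pverts (T j)" "v \<in> {a, b, c}" "(u, v) \<in> parcs G" "k' u" "k' v"
        using link[OF 1(2)] by blast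
      have "(v, u) \<in> parcs G" using uv(3) pair_graph_sym[OF G] by simp
      then show ?thesis
        unfolding T'_simps(2)[OF 1(2)] 1(1) T'_simps(1) P(1) using uv by blast
    next
      case 2
      show ?thesis
        unfolding T'_simps(2)[OF 2(2)] 2(1) T'_simps(1) P(1) by (rule link[OF 2(2)])
    next
      case 3
      obtain u v where uv: "u \<in> pverts (T i)" "v \<in> pverts (T j)" "(u, v) \<in> parcs G" "k u" "k v"
        using join[OF 3 j(2)] by blast
      then have "k' u" "k' v" using k'T 3 by simp_all
      then show ?thesis
        unfolding T'_simps(2)[OF 3(1)] T'_simps(2)[OF 3(2)] using uv by blast
    qed
  qed
qed

lemma odd_minor_in_packing:
  assumes G: "pair_graph G" and H: "triangle_P3_K2_free (nonadj G)"
    and "triangle_P3_K2_free.packing (nonadj G) p X" "X \<subseteq> pverts G" "S \<inter> X = {}" "odd_minor_in G S t"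
  shows "odd_minor_in G (S \<union> X) (t + p)"
proof -
  interpret triangle_P3_K2_free "nonadj G" by (rule H)
  have in_arcs: "(x, y) \<in> parcs G" if "x \<in> pverts G" "y \<in> pverts G" "x \<noteq> y" "\<not> nonadj G x y" for x y
    using that by (simp add: nonadj_def)
  show ?thesis
    using assms(3-)
  proof (induction rule: packing.induct)
    case (packing_0 X)
    then show ?case using odd_minor_in_mono[of G S t "S \<union> X"] by simp
  next
    case (packing_Suc n X a b c Y)
    have IH: "odd_minor_in G (S \<union> X) (t + n)"
      using packing_Suc by blast
    have V: "a \<in> pverts G" "b \<in> pverts G" "c \<in> pverts G" using packing_Suc by auto
    have sg: "nonadj G a b" "\<not> nonadj G a c" "\<not> nonadj G b c" "c \<noteq> a" "c \<noteq> b" "a \<noteq> b"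
      using packing_Suc.hyps(2) by (auto simp: seagull_def nonadj_def)
    \<comment> \<open>In \<open>G\<close> the middle of the path is \<open>c\<close>. A vertex
      adjacent in \<open>G\<close> to neither \<open>a\<close> nor \<open>b\<close> would form a
      triangle with them in the complement.\<close>
    have "odd_minor_in G ((S \<union> X) \<union> {a, c, b}) (Suc (t + n))"
    proof (rule odd_minor_in_path3[OF G IH])
      show "distinct [a, c, b]" using sg by simp
      show dj: "{a, c, b} \<inter> (S \<union> X) = {}" using packing_Suc.hyps packing_Suc.prems by auto
      show "(a, c) \<in> parcs G" using in_arcs[of a c] V sg by auto
      show "(c, b) \<in> parcs G" using in_arcs[of b c] V sg pair_graph_sym[OF G] by auto
      show "(y, a) \<in> parcs G \<or> (y, b) \<in> parcs G" if y: "y \<in> S \<union> X" "y \<in> pverts G" for y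
      proof (rule ccontr)
        assume "\<not> ?thesis"
        then have "nonadj G y a" "nonadj G y b" using y dj V by (auto simp: nonadj_def)
        then show False using triangle_free[OF _ sg(1), of y] by blast
      qed
    qed
    then show ?case using packing_Suc.hyps by (auto elim!: odd_minor_in_mono)
  qed
qed

text \<open>Distinct vertices of one class are matched, hence not adjacent in \<open>G\<close>, so
  numbering the classes gives a proper colouring.\<close>

lemma chromatic_number_le_matching:
  assumes G: "pair_graph G" and H: "simple_graph (nonadj G)"
    and f: "simple_graph.matching (nonadj G) (pverts G) f"
  shows "chromatic_number G \<le> card ((\<lambda>x. {x, f x}) ` pverts G)"
proof -
  interpret simple_graph "nonadj G" by (rule H)
  interpret G: pair_graph G by (rule G)
  let ?C = "(\<lambda>x. {x, f x}) ` pverts G"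
  have "finite ?C" using G.pair_finite_verts by simp
  then obtain h where h: "bij_betw h ?C {0..<card ?C}"
    using ex_bij_betw_finite_nat by blast
  have "proper_coloring G (card ?C) (\<lambda>x. h {x, f x})"
    unfolding proper_coloring_def
  proof (intro conjI ballI)
    show "h {x, f x} < card ?C" if "x \<in> pverts G" for x
      using h that by (auto simp: bij_betw_def)
    fix e assume e: "e \<in> parcs G"
    obtain x y where xy: "e = (x, y)" by (cases e)
    have V: "x \<in> pverts G" "y \<in> pverts G" "x \<noteq> y"
      using e xy G.in_arcsD1 G.in_arcsD2 pair_graph_irrefl[OF G] by auto
    have "h {x, f x} \<noteq> h {y, f y}"
    proof
      assume "h {x, f x} = h {y, f y}"
      then have "{x, f x} = {y, f y}" using h V by (auto simp: bij_betw_def dest: inj_onD)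
      then have "f x = y" using V by (auto simp: doubleton_eq_iff)
      then have "nonadj G x y" using matching_adj[OF f, of x] V by auto
      then show False using e xy by (simp add: nonadj_def)
    qed
    then show "case e of (u, v) \<Rightarrow> h {u, f u} \<noteq> h {v, f v}" using xy by simp
  qed
  then show ?thesis unfolding chromatic_number_def by (intro Least_le) blast
qed

theorem theorem1p10:
  fixes G :: "'a pair_pre_digraph"
  assumes "pair_graph G"
    and "free_of {edgeless_graph_3, paraglider} G"
  shows "oh G \<ge> chromatic_number G"
proof -
  interpret G: pair_graph G by fact
  have H: "triangle_P3_K2_free (nonadj G)" by (rule triangle_P3_K2_free_nonadj[OF assms])
  interpret triangle_P3_K2_free "nonadj G" by (rule H)
  obtain f S X p where f: "matching (pverts G) f" and S: "S \<subseteq> pverts G" "X \<subseteq> pverts G - S" "indep S"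
    and p: "packing p X" and le: "card (pverts G) + card (unmatched (pverts G) f) \<le> 2 * (card S + p)"
    using ex_matching_indep_packing[OF G.pair_finite_verts] by blast
  have "odd_minor_in G S (card S)"
    using S(1,3) finite_subset[OF S(1) G.pair_finite_verts]
    by (intro odd_minor_in_clique[OF assms(1)]) (auto simp: indep_def nonadj_def)
  then have "odd_minor_in G (S \<union> X) (card S + p)"
    using S(2) by (intro odd_minor_in_packing[OF assms(1) H p]) auto
  then have "has_odd_clique_minor G (card S + p)"
    by (rule has_odd_clique_minor_if_odd_minor_in)
  then have "card S + p \<le> oh G"
    unfolding oh_def using has_odd_clique_minor_le_card[OF assms(1)] by (intro Greatest_le_nat) blast+
  moreover have "card ((\<lambda>x. {x, f x}) ` pverts G) \<le> card S + p"
    using ord_eq_le_trans[OF card_matching_classes[OF G.pair_finite_verts f] le] by simp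
  moreover have "chromatic_number G \<le> card ((\<lambda>x. {x, f x}) ` pverts G)"
    by (rule chromatic_number_le_matching[OF assms(1) simple_graph_axioms f])
  ultimately show ?thesis by linarith
qed

end
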